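(* Let $\alpha\in(0,1]$. For almost all $x\in(0,1)$ and $y\in(-\infty,-1)$, the sequence $\{{\bf T}_\alpha^n(x,y)\}_{n\ge1}$ is distributed in $\Omega_\alpha$ according to the density $f_\alpha(x,y)=c_\alpha (x-y)^{-2}$; that is, for every Borel set $B\subset\Omega_\alpha$ whose boundary has Lebesgue measure zero, $$\lim_{k\to\infty}\frac1k\#\{0<j<k: {\bf T}_\alpha^j(x,y)\in B\}=\int_B c_\alpha (u-v)^{-2}\,du\,dv.$$
   Context: $[r]$ is the greatest integer $\le r$. $\Omega=(0,1)\times(-\infty,-1)$, ${\bf T}(x,y)=(1/x-[1/x],\,1/y-[1/x])$, and $\Omega_\alpha=\{(x,y)\in\Omega: 1/(x-y)<\alpha\}$. For $(x,y)\in\Omega$, $\tau_\alpha(x,y)=\min\{n\ge1:{\bf T}^n(x,y)\in\Omega_\alpha\}$ and ${\bf T}_\alpha(x,y)={\bf T}^{\tau_\alpha(x,y)}(x,y)$ (first return/hitting map to $\Omega_\alpha$), with ${\bf T}_\alpha^n$ its $n$-th iterate. The constant $c_\alpha$ is the normalizing constant $c_\alpha=\big(\int_{\Omega_\alpha}(x-y)^{-2}\,dx\,dy\big)^{-1}$, so that $c_\alpha(x-y)^{-2}dx\,dy$ is a probability measure on $\Omega_\alpha$. *)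

theory Defs
  imports "HOL-Analysis.Analysis"
begin

definition Omega :: "(real \<times> real) set" where
  "Omega = {0<..<1} \<times> {..<-1}"

(* With 1 / 0 = 0 this is total; a point with x = 0 is sent to a point with x = 0,
   so an orbit that leaves Omega (only possible for rational x) never comes back. *)
definition T :: "real \<times> real \<Rightarrow> real \<times> real" where
  "T = (\<lambda>(x, y). (1 / x - of_int \<lfloor>1 / x\<rfloor>, 1 / y - of_int \<lfloor>1 / x\<rfloor>))"

definition Omega_sub :: "real \<Rightarrow> (real \<times> real) set" where
  "Omega_sub \<alpha> = {(x, y). (x, y) \<in> Omega \<and> 1 / (x - y) < \<alpha>}"

(* The value is unspecified on the exceptional set of points whose orbit never enters
   Omega_sub \<alpha>. *)
definition tau :: "real \<Rightarrow> real \<times> real \<Rightarrow> nat" where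
  "tau \<alpha> z = (LEAST n. n \<ge> 1 \<and> (T ^^ n) z \<in> Omega_sub \<alpha>)"

definition T_sub :: "real \<Rightarrow> real \<times> real \<Rightarrow> real \<times> real" where
  "T_sub \<alpha> z = (T ^^ tau \<alpha> z) z"

definition c_norm :: "real \<Rightarrow> real" where
  "c_norm \<alpha> = inverse (set_lebesgue_integral lborel (Omega_sub \<alpha>) (\<lambda>(x, y). 1 / (x - y)\<^sup>2))"

definition f_dens :: "real \<Rightarrow> real \<times> real \<Rightarrow> real" where
  "f_dens \<alpha> = (\<lambda>(x, y). c_norm \<alpha> * (1 / (x - y)\<^sup>2))"

end

theory Submission
  imports Defs "HOL-Real_Asymp.Real_Asymp"
begin

text \<open>
  The first coordinate of \<open>T\<close> is the Gauss map. Its transfer operator maps monotone functions to monotone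
  functions and halves their oscillation, so the correlations of the indicator of \<open>{x < s}\<close> along an orbit
  decay like \<open>2\<close> to the power \<open>-n\<close>. The variance of the visit counts therefore grows linearly, which gives
  the strong law along the squares and, by monotonicity of the counts, along all integers.

  For the pair \<open>(x, y)\<close> no further ergodic theory is needed: \<open>T\<close> maps
  \<open>{1 / (b + s) < x < 1 / b, y < - 1 / \<theta>}\<close> onto \<open>{x < s, - b - \<theta> < y < - b}\<close>, so the frequency of visits to
  \<open>{x < s, y < - c}\<close> is found by running the Euclidean algorithm on the rational number \<open>c\<close>, starting from
  the one-dimensional case \<open>c = 1\<close>. Rational boxes approximate open sets from inside, and a set with null
  boundary is squeezed between an open and a closed one. The first return map visits \<open>B\<close> with the ratio of
  the frequencies of \<open>B\<close> and of \<open>Omega_sub \<alpha>\<close>.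
\<close>

section \<open>The transfer operator of the Gauss map\<close>

text \<open>\<open>T\<close> is a natural extension of the Gauss map: y records the past partial
  quotients, and the integer part of -y is the digit that the last step removed. Hence a strip b <
  -y < b + \<theta> is a condition on the preceding point, and there only the bound y < -1/\<theta>
  is left on the second coordinate. The corner at c = b + \<theta> is the corner at b minus such a
  strip, so c is reduced to b and 1/\<theta>. For c = p/q the new denominator is the remainder of p
  modulo q, which is why the reduction ends and why c is rational. Points with a rational coordinate
  are discarded beforehand; the remaining orbits never meet the side of a rational box, so strict
  and weak inequalities agree along them. All other exceptional points are described by x alone. The
  branches 1/(k + 1 + x) decrease in x, so the operator exchanges increasing and decreasing
  functions. Monotonicity matters because it makes the oscillation a difference of two endpoint
  values, and those can be compared exactly. Upper bounds on correlations are enough, since they are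
  only summed into an upper bound for a variance.\<close>

definition gauss_map :: "real \<Rightarrow> real" where
  "gauss_map x = frac (1 / x)"

definition gauss_weight :: "nat \<Rightarrow> real \<Rightarrow> real" where
  "gauss_weight k x = (1 + x) / ((real k + 1 + x) * (real k + 2 + x))"

text \<open>The transfer operator of the Gauss map with respect to the Gauss measure: \<open>gauss_weight k x\<close> is the
  conditional probability that the partial quotient in front of \<open>x\<close> is \<open>k + 1\<close>.\<close>

definition gauss_op :: "(real \<Rightarrow> real) \<Rightarrow> real \<Rightarrow> real" where
  "gauss_op f x = (\<Sum>k. gauss_weight k x * f (1 / (real k + 1 + x)))"

definition gauss_measure :: "real measure" where
  "gauss_measure = density lborel (\<lambda>x. ennreal (indicator {0<..<1} x / ((1 + x) * ln 2)))"

lemma gauss_weight_nonneg: "0 \<le> x \<Longrightarrow> 0 \<le> gauss_weight k x"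
  by (simp add: gauss_weight_def)

lemma gauss_weight_telescope:
  "0 \<le> x \<Longrightarrow> gauss_weight k x = (1 + x) / (real k + 1 + x) - (1 + x) / (real (Suc k) + 1 + x)"
  by (simp add: gauss_weight_def field_simps)

lemma gauss_weight_sums:
  assumes "0 \<le> x" shows "(\<lambda>k. gauss_weight k x) sums 1"
proof -
  have "(\<lambda>k. (1 + x) / (real k + 1 + x)) \<longlonglongrightarrow> 0"
    by real_asymp
  from telescope_sums'[OF this] show ?thesis
    using assms by (simp add: gauss_weight_telescope)
qed

lemma gauss_op_summable:
  assumes "0 \<le> x" "x \<le> 1" and f: "\<And>t. t \<in> {0..1} \<Longrightarrow> \<bar>f t\<bar> \<le> C"
  shows "summable (\<lambda>k. gauss_weight k x * f (1 / (real k + 1 + x)))"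
proof (rule summable_comparison_test')
  show "summable (\<lambda>k. gauss_weight k x * C)"
    using gauss_weight_sums[OF assms(1)] by (intro summable_mult2) (simp add: sums_iff)
  show "norm (gauss_weight k x * f (1 / (real k + 1 + x))) \<le> gauss_weight k x * C" for k
    using assms(1) gauss_weight_nonneg[OF assms(1), of k]
    by (simp only: real_norm_def abs_mult abs_of_nonneg) (intro mult_left_mono f, auto simp: field_simps)
qed

lemma gauss_op_const: "0 \<le> x \<Longrightarrow> gauss_op (\<lambda>_. c) x = c"
  using sums_mult2[OF gauss_weight_sums, of x c] by (simp add: gauss_op_def sums_iff)

lemma gauss_op_diff:
  assumes "0 \<le> x" "x \<le> 1" and "\<And>t. t \<in> {0..1} \<Longrightarrow> \<bar>f t\<bar> \<le> C"
  shows "gauss_op (\<lambda>t. c - f t) x = c - gauss_op f x"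
proof -
  have "(\<lambda>k. gauss_weight k x * c - gauss_weight k x * f (1 / (real k + 1 + x))) sums (1 * c - gauss_op f x)"
    unfolding gauss_op_def
    by (intro sums_diff sums_mult2 gauss_weight_sums summable_sums gauss_op_summable[where C = C] assms)
  then show ?thesis
    by (simp add: gauss_op_def sums_iff algebra_simps)
qed

lemma gauss_op_bounds:
  assumes "0 \<le> x" "x \<le> 1" and f: "\<And>t. t \<in> {0..1} \<Longrightarrow> f t \<in> {0..1}"
  shows "gauss_op f x \<in> {0..1}"
proof -
  have s: "summable (\<lambda>k. gauss_weight k x * f (1 / (real k + 1 + x)))"
    using f by (intro gauss_op_summable[where C = 1] assms) force
  have b: "0 \<le> f (1 / (real k + 1 + x))" "f (1 / (real k + 1 + x)) \<le> 1" for k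
    using f[of "1 / (real k + 1 + x)"] assms(1) by (auto simp: field_simps)
  have "gauss_op f x \<le> (\<Sum>k. gauss_weight k x)"
    unfolding gauss_op_def using gauss_weight_sums[OF assms(1)] s b gauss_weight_nonneg[OF assms(1)]
    by (intro suminf_le) (auto simp: sums_iff mult_left_le)
  moreover have "0 \<le> gauss_op f x"
    unfolding gauss_op_def using s b gauss_weight_nonneg[OF assms(1)] by (intro suminf_nonneg) auto
  ultimately show ?thesis
    using gauss_weight_sums[OF assms(1)] by (simp add: sums_iff)
qed

lemma gauss_op_measurable [measurable]:
  assumes [measurable]: "f \<in> borel_measurable borel"
  shows "gauss_op f \<in> borel_measurable borel"
  unfolding gauss_op_def[abs_def] gauss_weight_def by measurable

text \<open>Abel summation, with the tails \<open>(1 + x) / (j + 1 + x)\<close> of the weights increasing in \<open>x\<close>.\<close>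

lemma gauss_op_antimono:
  assumes mono: "mono_on {0..1} f" and f: "\<And>t. t \<in> {0..1} \<Longrightarrow> f t \<in> {0..1}"
  shows "antimono_on {0..1} (gauss_op f)"
proof (intro monotone_onI)
  fix x y :: real assume xy: "x \<in> {0..1}" "y \<in> {0..1}" "x \<le> y"
  define a where "a k = f (1 / (real k + 1 + x))" for k :: nat
  define D where "D k = (1 + x) / (real k + 1 + x) - (1 + y) / (real k + 1 + y)" for k :: nat
  have in01: "1 / (real k + 1 + u) \<in> {0..1}" if "u \<in> {0..1}" for k u
    using that by (auto simp: field_simps)
  have D0: "D 0 = 0" using xy by (simp add: D_def)
  have D: "D k \<le> 0" for k
  proof -
    have "(1 + u) / (real k + 1 + u) = 1 - real k / (real k + 1 + u)" if "u \<in> {0..1}" for u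
      using that by (simp add: field_simps)
    moreover have "real k / (real k + 1 + y) \<le> real k / (real k + 1 + x)"
      using xy by (intro divide_left_mono) (auto intro!: mult_pos_pos)
    ultimately show ?thesis
      using xy by (simp add: D_def)
  qed
  have a0: "0 \<le> a k" for k
    using f[OF in01[OF xy(1)]] by (simp add: a_def)
  have adec: "a (Suc k) \<le> a k" for k
    unfolding a_def using xy in01[OF xy(1), of k] in01[OF xy(1), of "Suc k"]
    by (intro mono_onD[OF mono]) (auto simp: field_simps)
  \<comment> \<open>Summation by parts starting from \<open>D 0 = 0\<close>: raising n adds
    \<open>D (Suc n) * (a (Suc n) - a n)\<close>, a product of two nonpositive numbers.\<close>
  have part: "(\<Sum>k<Suc n. (D k - D (Suc k)) * a k) \<ge> - D (Suc n) * a n" for n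
  proof (induction n)
    case 0
    then show ?case using D0 by simp
  next
    case (Suc n)
    have "D (Suc n) * (a (Suc n) - a n) \<ge> 0"
      using D[of "Suc n"] adec[of n] by (simp add: mult_nonpos_nonpos)
    with Suc show ?case by (simp add: algebra_simps)
  qed
  have sx: "summable (\<lambda>k. gauss_weight k u * f (1 / (real k + 1 + v)))"
    if "u \<in> {0..1}" "v \<in> {0..1}" for u v
  proof (rule summable_comparison_test')
    show "summable (\<lambda>k. gauss_weight k u)"
      using gauss_weight_sums[of u] that by (simp add: sums_iff)
    show "norm (gauss_weight k u * f (1 / (real k + 1 + v))) \<le> gauss_weight k u" for k
      using that gauss_weight_nonneg[of u k] f[OF in01[OF that(2), of k]]
      by (simp add: abs_mult mult_left_le)
  qed
  \<comment> \<open>The change from y to x is made in two stages. Moving the branch points, with the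
    weights kept at y, uses that f increases; moving the weights, with the points kept at x, is the
    Abel summation.\<close>
  have "gauss_op f y \<le> (\<Sum>k. gauss_weight k y * a k)"
    unfolding gauss_op_def
  proof (rule suminf_le)
    show "gauss_weight k y * f (1 / (real k + 1 + y)) \<le> gauss_weight k y * a k" for k
      unfolding a_def using xy in01[OF xy(1), of k] in01[OF xy(2), of k]
      by (intro mult_left_mono gauss_weight_nonneg mono_onD[OF mono]) (auto simp: field_simps)
  qed (use sx xy in \<open>auto simp: a_def\<close>)
  also have "\<dots> \<le> gauss_op f x"
  proof -
    have s: "(\<lambda>k. gauss_weight k x * a k - gauss_weight k y * a k) sums
        (gauss_op f x - (\<Sum>k. gauss_weight k y * a k))"
      unfolding gauss_op_def a_def using xy by (intro sums_diff summable_sums sx) auto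
    have "gauss_weight k x * a k - gauss_weight k y * a k = (D k - D (Suc k)) * a k" for k
      using xy by (simp add: gauss_weight_telescope D_def algebra_simps)
    with s have "(\<lambda>n. \<Sum>k<n. (D k - D (Suc k)) * a k) \<longlonglongrightarrow>
        gauss_op f x - (\<Sum>k. gauss_weight k y * a k)"
      by (simp add: sums_def)
    then have lim: "(\<lambda>n. \<Sum>k<Suc n. (D k - D (Suc k)) * a k) \<longlonglongrightarrow>
        gauss_op f x - (\<Sum>k. gauss_weight k y * a k)"
      by (rule LIMSEQ_Suc)
    have "0 \<le> (\<Sum>k<Suc n. (D k - D (Suc k)) * a k)" for n
      using part[of n] D[of "Suc n"] a0[of n] by (smt (verit) mult_nonneg_nonneg)
    then have "0 \<le> gauss_op f x - (\<Sum>k. gauss_weight k y * a k)"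
      by (intro LIMSEQ_le_const[OF lim]) blast
    then show ?thesis by simp
  qed
  finally show "gauss_op f y \<le> gauss_op f x" .
qed

text \<open>The branch points at 1 are those at 0 with the first one dropped, and the weights at 1
  are exactly twice the matching weights at 0. The dropped point is 1, of weight 1/2, so the
  difference equals \<open>f 1 / 2\<close> minus the rest of the sum at 0; that rest has total
  weight 1/2 and is at least \<open>f 0 / 2\<close>.\<close>

lemma gauss_op_osc:
  assumes mono: "mono_on {0..1} f" and f: "\<And>t. t \<in> {0..1} \<Longrightarrow> f t \<in> {0..1}"
  shows "gauss_op f 0 - gauss_op f 1 \<le> (f 1 - f 0) / 2"
proof -
  define b where "b k = gauss_weight k 0 * f (1 / (real k + 1 + 0))" for k
  have sb: "summable b"
    unfolding b_def using gauss_op_summable[of 0 f 1] f by force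
  have w: "gauss_weight k 1 * f (1 / (real k + 1 + 1)) = 2 * b (Suc k)" for k
    by (simp add: b_def gauss_weight_def field_simps)
  have b0: "b 0 = f 1 / 2" by (simp add: b_def gauss_weight_def)
  have split: "(\<Sum>k. b k) = (\<Sum>k. b (Suc k)) + b 0"
    using suminf_split_head[OF sb] by simp
  have "gauss_op f 0 - gauss_op f 1 = (\<Sum>k. b k) - 2 * (\<Sum>k. b (Suc k))"
    using sb unfolding gauss_op_def w b_def[symmetric] by (subst suminf_mult) (simp_all add: summable_Suc_iff)
  also have "\<dots> = f 1 / 2 - (\<Sum>k. b (Suc k))"
    using split b0 by simp
  also have "\<dots> \<le> f 1 / 2 - f 0 / 2"
  proof -
    have g: "(\<lambda>k. gauss_weight (Suc k) 0) sums (1 / 2)"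
      using gauss_weight_sums[of 0] by (subst sums_Suc_iff) (simp add: gauss_weight_def)
    have "f 0 / 2 = (\<Sum>k. gauss_weight (Suc k) 0 * f 0)"
      using sums_mult2[OF g, of "f 0"] by (simp add: sums_iff)
    also have "\<dots> \<le> (\<Sum>k. b (Suc k))"
    proof (rule suminf_le)
      show "gauss_weight (Suc k) 0 * f 0 \<le> b (Suc k)" for k
        unfolding b_def
        by (intro mult_left_mono gauss_weight_nonneg mono_onD[OF mono]) (auto simp: field_simps)
    qed (use sb sums_mult2[OF g, of "f 0"] in \<open>auto simp: sums_iff summable_Suc_iff\<close>)
    finally show ?thesis by simp
  qed
  finally show ?thesis by simp
qed

text \<open>The reflection 1 - f is increasing with values in the unit interval, and the operator
  commutes with it because the weights sum to 1.\<close>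

lemma gauss_op_antimono':
  assumes anti: "antimono_on {0..1} f" and f: "\<And>t. t \<in> {0..1} \<Longrightarrow> f t \<in> {0..1}"
  shows "mono_on {0..1} (gauss_op f)" "gauss_op f 1 - gauss_op f 0 \<le> (f 0 - f 1) / 2"
proof -
  have eq: "gauss_op (\<lambda>t. 1 - f t) x = 1 - gauss_op f x" if "x \<in> {0..1}" for x
    using that f by (intro gauss_op_diff[where C = 1]) force+
  have mono: "mono_on {0..1} (\<lambda>t. 1 - f t)"
    using anti by (auto simp: monotone_on_def)
  have f': "\<And>t. t \<in> {0..1} \<Longrightarrow> 1 - f t \<in> {0..1}"
    using f by auto
  show "mono_on {0..1} (gauss_op f)"
    using gauss_op_antimono[OF mono f'] eq by (auto simp: monotone_on_def)
  show "gauss_op f 1 - gauss_op f 0 \<le> (f 0 - f 1) / 2"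
    using gauss_op_osc[OF mono f'] eq[of 0] eq[of 1] by simp
qed

text \<open>The direction of monotonicity flips at each application, so the induction carries the
  disjunction of both directions together with the halving of the difference of the endpoint
  values.\<close>

lemma gauss_op_iterate:
  assumes "f \<in> borel_measurable borel" and "\<And>t. t \<in> {0..1} \<Longrightarrow> f t \<in> {0..1}"
    and "mono_on {0..1} f \<or> antimono_on {0..1} f"
  shows "(gauss_op ^^ n) f \<in> borel_measurable borel"
    and "t \<in> {0..1} \<Longrightarrow> (gauss_op ^^ n) f t \<in> {0..1}"
    and "s \<in> {0..1} \<Longrightarrow> t \<in> {0..1} \<Longrightarrow> \<bar>(gauss_op ^^ n) f s - (gauss_op ^^ n) f t\<bar> \<le> (1 / 2) ^ n"
proof -
  define F where "F n = (gauss_op ^^ n) f" for n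
  have *: "F n \<in> borel_measurable borel \<and> (\<forall>t\<in>{0..1}. F n t \<in> {0..1}) \<and>
      (mono_on {0..1} (F n) \<or> antimono_on {0..1} (F n)) \<and> \<bar>F n 1 - F n 0\<bar> \<le> (1 / 2) ^ n" for n
  proof (induction n)
    case 0
    have "\<bar>f 1 - f 0\<bar> \<le> 1" using assms(2)[of 0] assms(2)[of 1] by auto
    then show ?case using assms by (auto simp: F_def)
  next
    case (Suc n)
    have F: "F (Suc n) = gauss_op (F n)" by (simp add: F_def)
    have b: "\<And>t. t \<in> {0..1} \<Longrightarrow> F n t \<in> {0..1}" using Suc by blast
    from Suc have "mono_on {0..1} (F n) \<or> antimono_on {0..1} (F n)" by blast
    then have "(mono_on {0..1} (F (Suc n)) \<or> antimono_on {0..1} (F (Suc n))) \<and>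
      \<bar>F (Suc n) 1 - F (Suc n) 0\<bar> \<le> (1 / 2) ^ Suc n"
    proof
      assume m: "mono_on {0..1} (F n)"
      note a = gauss_op_antimono[OF m b, folded F] and o = gauss_op_osc[OF m b, folded F]
      have "F (Suc n) 1 \<le> F (Suc n) 0" using a by (auto simp: monotone_on_def)
      with o Suc a show ?thesis by (auto simp: abs_if split: if_splits)
    next
      assume m: "antimono_on {0..1} (F n)"
      note a = gauss_op_antimono'(1)[OF m b, folded F] and o = gauss_op_antimono'(2)[OF m b, folded F]
      have "F (Suc n) 0 \<le> F (Suc n) 1" using a by (auto simp: monotone_on_def)
      with o Suc a show ?thesis by (auto simp: abs_if split: if_splits)
    qed
    moreover have "F (Suc n) t \<in> {0..1}" if "t \<in> {0..1}" for t
      unfolding F using that by (intro gauss_op_bounds b) auto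
    moreover have "F (Suc n) \<in> borel_measurable borel"
      unfolding F by (rule gauss_op_measurable) (use Suc in blast)
    ultimately show ?case by blast
  qed
  show "(gauss_op ^^ n) f \<in> borel_measurable borel"
    and "t \<in> {0..1} \<Longrightarrow> (gauss_op ^^ n) f t \<in> {0..1}"
    using *[of n] by (auto simp: F_def)
  assume st: "s \<in> {0..1}" "t \<in> {0..1}"
  \<comment> \<open>In either direction of monotonicity all values lie between those at 0 and
    1.\<close>
  have "\<bar>F n s - F n t\<bar> \<le> \<bar>F n 1 - F n 0\<bar>"
    using *[of n] st monotone_onD[of "{0..1}" "(\<le>)" "(\<le>)" "F n" 0 s] monotone_onD[of "{0..1}" "(\<le>)" "(\<le>)" "F n" 0 t]
      monotone_onD[of "{0..1}" "(\<le>)" "(\<le>)" "F n" s 1] monotone_onD[of "{0..1}" "(\<le>)" "(\<le>)" "F n" t 1]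
      monotone_onD[of "{0..1}" "(\<le>)" "(\<ge>)" "F n" 0 s] monotone_onD[of "{0..1}" "(\<le>)" "(\<ge>)" "F n" 0 t]
      monotone_onD[of "{0..1}" "(\<le>)" "(\<ge>)" "F n" s 1] monotone_onD[of "{0..1}" "(\<le>)" "(\<ge>)" "F n" t 1]
    by auto
  then show "\<bar>(gauss_op ^^ n) f s - (gauss_op ^^ n) f t\<bar> \<le> (1 / 2) ^ n"
    using *[of n] by (auto simp: F_def)
qed

section \<open>The Gauss measure: duality with the transfer operator, and invariance\<close>

lemma gauss_map_measurable [measurable]: "gauss_map \<in> borel_measurable borel"
  unfolding gauss_map_def[abs_def] frac_def by measurable

lemma sets_gauss_measure [simp, measurable_cong]: "sets gauss_measure = sets borel"
  and space_gauss_measure [simp]: "space gauss_measure = UNIV"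
  by (simp_all add: gauss_measure_def)

lemma nn_integral_gauss_measure:
  assumes [measurable]: "h \<in> borel_measurable borel"
  shows "(\<integral>\<^sup>+x. ennreal (h x) \<partial>gauss_measure) =
    (\<integral>\<^sup>+x. ennreal (h x / ((1 + x) * ln 2)) * indicator {0<..<1} x \<partial>lborel)"
  unfolding gauss_measure_def
  by (subst nn_integral_density)
    (auto intro!: nn_integral_cong simp: indicator_def ennreal_mult'[symmetric])

lemma nn_integral_gauss_branch:
  fixes h :: "real \<Rightarrow> real"
  assumes [measurable]: "h \<in> borel_measurable borel"
  shows "(\<integral>\<^sup>+x. ennreal (h x) * indicator {1 / (real k + 2) <.. 1 / (real k + 1)} x \<partial>lborel) =
    (\<integral>\<^sup>+t. ennreal (h (1 / (real k + 1 + t)) / (real k + 1 + t)\<^sup>2) * indicator {0<..<1} t \<partial>lborel)"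
proof -
  \<comment> \<open>The inverse branch t \<mapsto> 1/(k + 1 + t) is decreasing. Writing s = -t gives
    an increasing substitution on [-1, 0] with nonnegative derivative; the sign is turned back
    afterwards by an affine change of variable.\<close>
  define \<phi> where "\<phi> s = 1 / (real k + 1 - s)" for s
  define \<phi>' where "\<phi>' s = 1 / (real k + 1 - s)\<^sup>2" for s
  have "(\<integral>\<^sup>+x. ennreal (h x) * indicator {1 / (real k + 2) <.. 1 / (real k + 1)} x \<partial>lborel) =
      (\<integral>\<^sup>+x. ennreal (h x) * indicator {\<phi> (-1) .. \<phi> 0} x \<partial>lborel)"
    by (intro nn_integral_cong_AE, use AE_lborel_singleton[of "1 / (real k + 2)"] in eventually_elim) (auto simp: \<phi>_def indicator_def add.commute)
  also have "\<dots> = (\<integral>\<^sup>+x. ennreal (h x * indicator {\<phi> (-1) .. \<phi> 0} x) \<partial>lborel)"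
    by (intro nn_integral_cong) (auto simp: indicator_def)
  also have "\<dots> = (\<integral>\<^sup>+x. ennreal (h (\<phi> x) * \<phi>' x * indicator {-1..0} x) \<partial>lborel)"
  proof (rule nn_integral_substitution)
    show "(\<phi> has_real_derivative \<phi>' x) (at x)" if "x \<in> {-1..0}" for x
      unfolding \<phi>_def[abs_def] \<phi>'_def using that
      by (auto intro!: derivative_eq_intros simp: power2_eq_square divide_simps)
    show "continuous_on {-1..0} \<phi>'"
      unfolding \<phi>'_def[abs_def] by (intro continuous_intros) auto
  qed (auto simp: \<phi>'_def set_borel_measurable_def)
  also have "\<dots> = (\<integral>\<^sup>+x. ennreal (h (\<phi> (- x)) * \<phi>' (- x) * indicator {-1..0} (- x)) \<partial>lborel)"
    unfolding \<phi>_def \<phi>'_def by (subst nn_integral_real_affine[where c = "-1" and t = 0]) auto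
  also have "\<dots> = (\<integral>\<^sup>+t. ennreal (h (1 / (real k + 1 + t)) / (real k + 1 + t)\<^sup>2) * indicator {0<..<1} t \<partial>lborel)"
    by (intro nn_integral_cong_AE, use AE_lborel_singleton[of 0] AE_lborel_singleton[of 1] in eventually_elim)
      (auto simp: \<phi>_def \<phi>'_def indicator_def)
  finally show ?thesis .
qed

text \<open>These intervals are the sets on which the first partial quotient, the integer part of
  1/x, equals k + 1; both claims follow from this description.\<close>

lemma gauss_branches_partition:
  "disjoint_family (\<lambda>k. {1 / (real k + 2) <.. 1 / (real k + 1)})"
  "(\<Union>k. {1 / (real k + 2) <.. 1 / (real k + 1)}) = {0<..1}"
proof -
  have nat: "x \<in> {1 / (real k + 2) <.. 1 / (real k + 1)} \<longleftrightarrow> 0 < x \<and> \<lfloor>1 / x\<rfloor> = int k + 1" for x k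
  proof (cases "0 < x")
    case True
    then have "x \<in> {1 / (real k + 2) <.. 1 / (real k + 1)} \<longleftrightarrow> real k + 1 \<le> 1 / x \<and> 1 / x < real k + 2"
      by (auto simp: field_simps)
    then show ?thesis using True by (auto simp: floor_eq_iff)
  next
    case False
    then show ?thesis by (auto simp: not_less intro: order.strict_trans2 dest: less_le_trans)
      (smt (verit) divide_nonneg_nonneg of_nat_0_le_iff)
  qed
  show "disjoint_family (\<lambda>k. {1 / (real k + 2) <.. 1 / (real k + 1)})"
    unfolding disjoint_family_on_def using nat by fastforce
  show "(\<Union>k. {1 / (real k + 2) <.. 1 / (real k + 1)}) = {0<..1::real}"
  proof (intro set_eqI iffI)
    fix x :: real assume "x \<in> {0<..1}"
    then have "0 < x" "1 \<le> \<lfloor>1 / x\<rfloor>" by (auto simp: field_simps)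
    then have "x \<in> {1 / (real (nat (\<lfloor>1 / x\<rfloor> - 1)) + 2) <.. 1 / (real (nat (\<lfloor>1 / x\<rfloor> - 1)) + 1)}"
      by (subst nat) auto
    then show "x \<in> (\<Union>k. {1 / (real k + 2) <.. 1 / (real k + 1)})" by blast
  next
    fix x :: real assume "x \<in> (\<Union>k. {1 / (real k + 2) <.. 1 / (real k + 1)})"
    then obtain k where k: "x \<in> {1 / (real k + 2) <.. 1 / (real k + 1)}" by blast
    moreover have "1 / (real k + 1) \<le> 1" by simp
    ultimately have "x \<le> 1" unfolding greaterThanAtMost_iff by linarith
    with k show "x \<in> {0<..1}" by (simp only: nat) simp
  qed
qed

text \<open>The integral is split over the branches and each piece is pulled back to (0, 1). There
  the Jacobian times the Gauss density at the branch point is \<open>gauss_weight\<close> times the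
  Gauss density at t, which is where the weights come from. With g nonnegative, sum and integral may
  be exchanged freely.\<close>

lemma gauss_op_dual:
  assumes [measurable]: "f \<in> borel_measurable borel" "g \<in> borel_measurable borel"
    and f: "\<And>t. t \<in> {0..1} \<Longrightarrow> f t \<in> {0..1}" and g: "\<And>t. 0 \<le> g t"
  shows "(\<integral>\<^sup>+x. ennreal (f x * g (gauss_map x)) \<partial>gauss_measure) =
    (\<integral>\<^sup>+x. ennreal (gauss_op f x * g x) \<partial>gauss_measure)"
proof -
  define h where "h x = f x * g (gauss_map x) / ((1 + x) * ln 2)" for x
  have [measurable]: "h \<in> borel_measurable borel" unfolding h_def[abs_def] by measurable
  have "(\<integral>\<^sup>+x. ennreal (f x * g (gauss_map x)) \<partial>gauss_measure) =
      (\<integral>\<^sup>+x. ennreal (h x) * indicator {0<..1} x \<partial>lborel)"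
    unfolding h_def
    by (subst nn_integral_gauss_measure, simp, intro nn_integral_cong_AE,
      use AE_lborel_singleton[of 1] in eventually_elim) (auto simp: indicator_def)
  also have "\<dots> = (\<Sum>k. \<integral>\<^sup>+x. ennreal (h x) * indicator {1 / (real k + 2) <.. 1 / (real k + 1)} x \<partial>lborel)"
    unfolding gauss_branches_partition(2)[symmetric]
    by (rule nn_integral_disjoint_family) (auto simp: gauss_branches_partition(1))
  also have "\<dots> = (\<Sum>k. \<integral>\<^sup>+t. ennreal (gauss_weight k t * f (1 / (real k + 1 + t)) * (g t / ((1 + t) * ln 2))) *
      indicator {0<..<1} t \<partial>lborel)"
  proof (intro arg_cong[where f = suminf] ext, subst nn_integral_gauss_branch, simp, intro nn_integral_cong)
    fix k t
    \<comment> \<open>The factor \<open>real k + 2 + t\<close> comes from 1 + x at the branch point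
      x = 1/(k + 1 + t); one of the two Jacobian factors \<open>real k + 1 + t\<close> cancels, and
      the other remains in the weight.\<close>
    have "h (1 / (real k + 1 + t)) / (real k + 1 + t)\<^sup>2 =
        gauss_weight k t * f (1 / (real k + 1 + t)) * (g t / ((1 + t) * ln 2))" if t: "t \<in> {0<..<1}"
    proof -
      have "gauss_map (1 / (real k + 1 + t)) = t"
        using t by (simp add: gauss_map_def frac_unique_iff) 
      moreover have "1 + 1 / (real k + 1 + t) = (real k + 2 + t) / (real k + 1 + t)"
        using t by (simp add: field_simps)
      ultimately show ?thesis
        using t by (simp add: h_def gauss_weight_def power2_eq_square) 
    qed
    then show "ennreal (h (1 / (real k + 1 + t)) / (real k + 1 + t)\<^sup>2) * indicator {0<..<1} t =
      ennreal (gauss_weight k t * f (1 / (real k + 1 + t)) * (g t / ((1 + t) * ln 2))) * indicator {0<..<1} t"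
      by (auto simp: indicator_def)
  qed
  also have "\<dots> = (\<integral>\<^sup>+t. (\<Sum>k. ennreal (gauss_weight k t * f (1 / (real k + 1 + t)) * (g t / ((1 + t) * ln 2))) *
      indicator {0<..<1} t) \<partial>lborel)"
    unfolding gauss_weight_def by (subst nn_integral_suminf) auto
  also have "\<dots> = (\<integral>\<^sup>+x. ennreal (gauss_op f x * g x) \<partial>gauss_measure)"
  proof (subst nn_integral_gauss_measure, simp, intro nn_integral_cong)
    fix t
    have "(\<Sum>k. ennreal (gauss_weight k t * f (1 / (real k + 1 + t)) * (g t / ((1 + t) * ln 2)))) =
        ennreal (gauss_op f t * g t / ((1 + t) * ln 2))" if t: "t \<in> {0<..<1}"
    proof -
      have s: "summable (\<lambda>k. gauss_weight k t * f (1 / (real k + 1 + t)))"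
        using f t by (intro gauss_op_summable[where C = 1]) force+
      have "0 \<le> f (1 / (real k + 1 + t))" for k
        using t f[of "1 / (real k + 1 + t)"] by (auto simp: field_simps)
      then have "(\<Sum>k. ennreal (gauss_weight k t * f (1 / (real k + 1 + t)) * (g t / ((1 + t) * ln 2)))) =
          ennreal (\<Sum>k. gauss_weight k t * f (1 / (real k + 1 + t)) * (g t / ((1 + t) * ln 2)))"
        using t g s by (intro suminf_ennreal2 summable_mult2 mult_nonneg_nonneg gauss_weight_nonneg) auto
      also have "(\<Sum>k. gauss_weight k t * f (1 / (real k + 1 + t)) * (g t / ((1 + t) * ln 2))) =
          gauss_op f t * (g t / ((1 + t) * ln 2))"
        by (simp only: gauss_op_def suminf_mult2[OF s])
      finally show ?thesis by simp
    qed
    then show "(\<Sum>k. ennreal (gauss_weight k t * f (1 / (real k + 1 + t)) * (g t / ((1 + t) * ln 2))) *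
        indicator {0<..<1} t) = ennreal (gauss_op f t * g t / ((1 + t) * ln 2)) * indicator {0<..<1} t"
      by (cases "t \<in> {0<..<1}") auto
  qed
  finally show ?thesis .
qed

lemma emeasure_gauss_measure_lessThan:
  assumes "0 \<le> s" "s \<le> 1"
  shows "emeasure gauss_measure {..<s} = ennreal (ln (1 + s) / ln 2)"
proof -
  have "emeasure gauss_measure {..<s} = (\<integral>\<^sup>+x. ennreal (indicator {..<s} x) \<partial>gauss_measure)"
    by (subst ennreal_indicator) simp
  also have "\<dots> = (\<integral>\<^sup>+x. ennreal (1 / ((1 + x) * ln 2)) * indicator {0..s} x \<partial>lborel)"
    by (subst nn_integral_gauss_measure, simp, intro nn_integral_cong_AE,
      use AE_lborel_singleton[of 0] AE_lborel_singleton[of s] in eventually_elim)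
      (use assms in \<open>auto simp: indicator_def\<close>)
  also have "\<dots> = ln (1 + s) / ln 2 - ln (1 + 0) / ln 2"
  proof (rule nn_integral_FTC_Icc[where F = "\<lambda>x. ln (1 + x) / ln 2"])
    fix x assume "x \<in> {0..s}"
    then have "((\<lambda>x. ln (1 + x)) has_real_derivative 1 / (1 + x)) (at x)"
      by (auto intro!: derivative_eq_intros)
    from DERIV_cdivide[OF this, of "ln 2"]
    show "((\<lambda>x. ln (1 + x) / ln 2) has_real_derivative 1 / ((1 + x) * ln 2)) (at x)"
      by simp
  qed (use assms in auto)
  finally show ?thesis by simp
qed

lemma emeasure_gauss_measure_UNIV: "emeasure gauss_measure UNIV = 1"
proof -
  have "emeasure gauss_measure UNIV = (\<integral>\<^sup>+x. ennreal 1 \<partial>gauss_measure)" by simp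
  also have "\<dots> = (\<integral>\<^sup>+x. ennreal (indicator {..<1} x) \<partial>gauss_measure)"
    by (subst (1 2) nn_integral_gauss_measure) (auto intro!: nn_integral_cong simp: indicator_def)
  also have "\<dots> = emeasure gauss_measure {..<1}"
    by (subst ennreal_indicator) simp
  finally show ?thesis by (simp add: emeasure_gauss_measure_lessThan)
qed

interpretation gauss: finite_measure gauss_measure
  by (rule finite_measureI) (simp add: emeasure_gauss_measure_UNIV)

text \<open>Duality with f = 1: the operator fixes constants, so composing g with the Gauss map
  leaves its integral unchanged.\<close>

lemma distr_gauss_map: "distr gauss_measure gauss_measure gauss_map = gauss_measure"
proof (rule measure_eqI)
  fix A assume "A \<in> sets (distr gauss_measure gauss_measure gauss_map)"
  then have [measurable]: "A \<in> sets borel" by simp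
  have "emeasure (distr gauss_measure gauss_measure gauss_map) A =
      (\<integral>\<^sup>+x. ennreal (indicator A (gauss_map x)) \<partial>gauss_measure)"
  proof -
    have "emeasure (distr gauss_measure gauss_measure gauss_map) A = emeasure gauss_measure (gauss_map -` A)"
      by (subst emeasure_distr) auto
    also have "\<dots> = (\<integral>\<^sup>+x. indicator (gauss_map -` A) x \<partial>gauss_measure)"
      using measurable_sets[OF gauss_map_measurable, of A] by simp
    also have "\<dots> = (\<integral>\<^sup>+x. ennreal (indicator A (gauss_map x)) \<partial>gauss_measure)"
      by (intro nn_integral_cong) (auto simp: indicator_def)
    finally show ?thesis .
  qed
  also have "\<dots> = (\<integral>\<^sup>+x. ennreal (gauss_op (\<lambda>_. 1) x * indicator A x) \<partial>gauss_measure)"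
    by (subst gauss_op_dual[symmetric]) auto
  also have "\<dots> = (\<integral>\<^sup>+x. ennreal (indicator A x) \<partial>gauss_measure)"
    by (subst (1 2) nn_integral_gauss_measure)
      (auto intro!: nn_integral_cong simp: indicator_def gauss_op_const)
  finally show "emeasure (distr gauss_measure gauss_measure gauss_map) A = emeasure gauss_measure A"
    by (simp add: ennreal_indicator)
qed simp

section \<open>Decay of correlations and the strong law\<close>

definition has_freq :: "(nat \<Rightarrow> bool) \<Rightarrow> real \<Rightarrow> bool" where
  "has_freq P l \<longleftrightarrow> (\<lambda>N. real (card {n. n < N \<and> P n}) / real N) \<longlonglongrightarrow> l"

lemma card_eq_sum_of_bool:
  fixes N :: nat
  shows "real (card {n. n < N \<and> P n}) = (\<Sum>n<N. of_bool (P n))"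
proof -
  have "{..<N} \<inter> {n. P n} = {n. n < N \<and> P n}" by auto
  then show ?thesis by simp
qed

section \<open>Integrals along the orbit and the variance of the visit counts\<close>

lemma gauss_map_funpow_measurable [measurable]: "gauss_map ^^ n \<in> borel_measurable borel"
  by measurable

lemma AE_gauss_measure_iff:
  "(AE x in gauss_measure. P x) \<longleftrightarrow> (AE x in lborel. x \<in> {0<..<1} \<longrightarrow> P x)"
  unfolding gauss_measure_def
  by (subst AE_density) (auto intro!: AE_cong simp: indicator_def)

lemma measure_gauss_measure_UNIV [simp]: "measure gauss_measure UNIV = 1"
  by (simp add: measure_def emeasure_gauss_measure_UNIV)

lemma gauss_integrable:
  fixes h :: "real \<Rightarrow> real"
  assumes "h \<in> borel_measurable borel" and "\<And>x. x \<in> {0<..<1} \<Longrightarrow> \<bar>h x\<bar> \<le> C"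
  shows "integrable gauss_measure h"
  using assms by (intro gauss.integrable_const_bound[of _ C]) (auto simp: AE_gauss_measure_iff)

lemma gauss_integral_invariant:
  fixes h :: "real \<Rightarrow> real"
  assumes "h \<in> borel_measurable borel"
  shows "(\<integral>x. h (gauss_map x) \<partial>gauss_measure) = (\<integral>x. h x \<partial>gauss_measure)"
  using assms by (subst (2) distr_gauss_map[symmetric], subst integral_distr) auto

lemma gauss_integral_invariant_funpow:
  fixes h :: "real \<Rightarrow> real"
  assumes [measurable]: "h \<in> borel_measurable borel"
  shows "(\<integral>x. h ((gauss_map ^^ n) x) \<partial>gauss_measure) = (\<integral>x. h x \<partial>gauss_measure)"
proof (induction n)
  case (Suc n)
  have "(\<integral>x. h ((gauss_map ^^ Suc n) x) \<partial>gauss_measure) =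
      (\<integral>x. h ((gauss_map ^^ n) (gauss_map x)) \<partial>gauss_measure)"
    by (simp add: funpow_swap1)
  also have "\<dots> = (\<integral>x. h ((gauss_map ^^ n) x) \<partial>gauss_measure)"
    by (intro gauss_integral_invariant) measurable
  finally show ?case using Suc by simp
qed simp

lemma gauss_op_dual_funpow:
  assumes "f \<in> borel_measurable borel" and g[measurable]: "g \<in> borel_measurable borel"
    and "\<And>t. t \<in> {0..1} \<Longrightarrow> f t \<in> {0..1}" and "\<And>t. 0 \<le> g t"
  shows "(\<integral>\<^sup>+x. ennreal (f x * g ((gauss_map ^^ n) x)) \<partial>gauss_measure) =
    (\<integral>\<^sup>+x. ennreal ((gauss_op ^^ n) f x * g x) \<partial>gauss_measure)"
  using assms(1,3)
proof (induction n arbitrary: f)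
  case (Suc n)
  have "(\<integral>\<^sup>+x. ennreal (f x * g ((gauss_map ^^ Suc n) x)) \<partial>gauss_measure) =
      (\<integral>\<^sup>+x. ennreal (f x * g ((gauss_map ^^ n) (gauss_map x))) \<partial>gauss_measure)"
    by (simp add: funpow_swap1)
  also have "\<dots> = (\<integral>\<^sup>+x. ennreal (gauss_op f x * g ((gauss_map ^^ n) x)) \<partial>gauss_measure)"
    using Suc.prems assms(4) by (intro gauss_op_dual measurable_compose[OF _ g]) auto
  also have "\<dots> = (\<integral>\<^sup>+x. ennreal ((gauss_op ^^ n) (gauss_op f) x * g x) \<partial>gauss_measure)"
    using Suc.prems by (intro Suc.IH gauss_op_measurable gauss_op_bounds) auto
  finally show ?case by (simp add: funpow_swap1)
qed simp

lemma gauss_op_dual_integral: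
  assumes f: "f \<in> borel_measurable borel" "\<And>t. t \<in> {0..1} \<Longrightarrow> f t \<in> {0..1}"
    "mono_on {0..1} f \<or> antimono_on {0..1} f"
    and g[measurable]: "g \<in> borel_measurable borel" and g0: "\<And>t. 0 \<le> g t"
  shows "(\<integral>x. f x * g ((gauss_map ^^ n) x) \<partial>gauss_measure) =
    (\<integral>x. (gauss_op ^^ n) f x * g x \<partial>gauss_measure)"
proof -
  note [measurable] = f(1) gauss_op_iterate(1)[OF f, of n]
  have "(\<integral>x. f x * g ((gauss_map ^^ n) x) \<partial>gauss_measure) =
      enn2real (\<integral>\<^sup>+x. ennreal (f x * g ((gauss_map ^^ n) x)) \<partial>gauss_measure)"
    using f(2) g0 by (intro integral_eq_nn_integral) (auto simp: AE_gauss_measure_iff)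
  also have "\<dots> = enn2real (\<integral>\<^sup>+x. ennreal ((gauss_op ^^ n) f x * g x) \<partial>gauss_measure)"
    using gauss_op_dual_funpow[OF f(1) g f(2) g0] by simp
  also have "\<dots> = (\<integral>x. (gauss_op ^^ n) f x * g x \<partial>gauss_measure)"
    using gauss_op_iterate(2)[OF f] g0
    by (intro integral_eq_nn_integral[symmetric]) (auto simp: AE_gauss_measure_iff)
  finally show ?thesis .
qed

text \<open>By duality with g = 1 the iterate has the same mean as f. Its oscillation is at most
  \<open>(1 / 2) ^ n\<close> and the measure has mass 1, so no value exceeds the mean by more than
  that.\<close>

lemma gauss_op_iterate_le_mean:
  assumes f: "f \<in> borel_measurable borel" "\<And>t. t \<in> {0..1} \<Longrightarrow> f t \<in> {0..1}"
    "mono_on {0..1} f \<or> antimono_on {0..1} f" and t: "t \<in> {0..1}"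
  shows "(gauss_op ^^ n) f t \<le> (\<integral>x. f x \<partial>gauss_measure) + (1 / 2) ^ n"
proof -
  note [measurable] = gauss_op_iterate(1)[OF f, of n]
  have "(gauss_op ^^ n) f t - (1 / 2) ^ n = (\<integral>x. (gauss_op ^^ n) f t - (1 / 2) ^ n \<partial>gauss_measure)"
    by simp
  also have "\<dots> \<le> (\<integral>x. (gauss_op ^^ n) f x \<partial>gauss_measure)"
  proof (rule integral_mono_AE)
    show "integrable gauss_measure ((gauss_op ^^ n) f)"
      using gauss_op_iterate(2)[OF f, of _ n] by (intro gauss_integrable[of _ 1]) force+
    show "AE x in gauss_measure. (gauss_op ^^ n) f t - (1 / 2) ^ n \<le> (gauss_op ^^ n) f x"
    proof -
      have "\<bar>(gauss_op ^^ n) f t - (gauss_op ^^ n) f x\<bar> \<le> (1 / 2) ^ n" if "x \<in> {0..1}" for x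
        using f t that by (intro gauss_op_iterate(3)) auto
      then have "(gauss_op ^^ n) f t - (1 / 2) ^ n \<le> (gauss_op ^^ n) f x" if "x \<in> {0..1}" for x
        using that by (smt (verit))
      then show ?thesis by (simp add: AE_gauss_measure_iff)
    qed
  qed simp
  also have "\<dots> = (\<integral>x. f x \<partial>gauss_measure)"
    using gauss_op_dual_integral[OF f, of "\<lambda>_. 1" n] by simp
  finally show ?thesis by simp
qed

text \<open>By invariance the covariance is the mean of \<open>f x * f ((gauss_map ^^ n) x)\<close>
  minus the square of m. Duality replaces the second factor by the iterate of the operator, which is
  at most \<open>m + (1 / 2) ^ n\<close>; as f is nonnegative, one side of the estimate is all that
  is integrated.\<close>

lemma gauss_correlation:
  fixes f :: "real \<Rightarrow> real"
  assumes f: "f \<in> borel_measurable borel" "\<And>t. f t \<in> {0..1}" "antimono_on {0..1} f"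
  defines "m \<equiv> \<integral>x. f x \<partial>gauss_measure"
  shows "(\<integral>x. (f x - m) * (f ((gauss_map ^^ n) x) - m) \<partial>gauss_measure) \<le> (1 / 2) ^ n"
proof -
  note [measurable] = f(1)
  have f': "f \<in> borel_measurable borel" "\<And>t. t \<in> {0..1} \<Longrightarrow> f t \<in> {0..1}"
    "mono_on {0..1} f \<or> antimono_on {0..1} f" using f by auto
  note [measurable] = gauss_op_iterate(1)[OF f', of n]
  have m: "m \<in> {0..1}"
  proof -
    have "0 \<le> m" unfolding m_def using f(2) by (intro integral_nonneg_AE) auto
    moreover have "m \<le> (\<integral>x. 1 \<partial>gauss_measure)"
      unfolding m_def using f(2) by (intro integral_mono gauss_integrable[of _ 1]) force+
    ultimately show ?thesis by simp
  qed
  have i: "integrable gauss_measure (\<lambda>x. f x * f ((gauss_map ^^ n) x))"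
    "integrable gauss_measure f" "integrable gauss_measure (\<lambda>x. f ((gauss_map ^^ n) x))"
    using f(2) by (auto intro!: gauss_integrable[of _ 1] simp: abs_mult mult_le_one)
  have "(\<integral>x. (f x - m) * (f ((gauss_map ^^ n) x) - m) \<partial>gauss_measure) =
      (\<integral>x. f x * f ((gauss_map ^^ n) x) - m * f x - m * f ((gauss_map ^^ n) x) + m * m \<partial>gauss_measure)"
    by (intro Bochner_Integration.integral_cong) (auto simp: algebra_simps)
  also have "\<dots> = (\<integral>x. f x * f ((gauss_map ^^ n) x) \<partial>gauss_measure) - m * m"
    using i gauss_integral_invariant_funpow[OF f(1), of n] by (simp add: m_def[symmetric])
  also have "(\<integral>x. f x * f ((gauss_map ^^ n) x) \<partial>gauss_measure) =
      (\<integral>x. (gauss_op ^^ n) f x * f x \<partial>gauss_measure)"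
    using f(2) by (intro gauss_op_dual_integral[OF f']) auto
  also have "\<dots> \<le> (\<integral>x. (m + (1 / 2) ^ n) * f x \<partial>gauss_measure)"
  proof (rule integral_mono_AE)
    show "integrable gauss_measure (\<lambda>x. (gauss_op ^^ n) f x * f x)"
      using gauss_op_iterate(2)[OF f', of _ n] f(2)
      by (intro gauss_integrable[of _ 1]) (auto simp: abs_mult mult_le_one)
    show "integrable gauss_measure (\<lambda>x. (m + (1 / 2) ^ n) * f x)" using i by simp
    show "AE x in gauss_measure. (gauss_op ^^ n) f x * f x \<le> (m + (1 / 2) ^ n) * f x"
      using gauss_op_iterate_le_mean[OF f', of _ n] f(2)
      by (auto simp: AE_gauss_measure_iff m_def intro!: mult_right_mono)
  qed
  also have "\<dots> = m * m + (1 / 2) ^ n * m" by (simp add: m_def[symmetric]) (simp add: algebra_simps)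
  also have "\<dots> - m * m \<le> (1 / 2) ^ n" using m by (simp add: mult_left_le)
  finally show ?thesis by simp
qed

text \<open>The first summand is split off, and the rest is the sum of length N evaluated at the
  image point, with the same second moment by invariance. Each step therefore adds at most 1 for the
  square of the new term and 2 for the cross terms, whose correlations are bounded by a geometric
  series of sum at most 1; hence the constant 3.\<close>

lemma gauss_second_moment:
  fixes f :: "real \<Rightarrow> real"
  assumes f: "f \<in> borel_measurable borel" "\<And>t. f t \<in> {0..1}" "antimono_on {0..1} f"
  defines "m \<equiv> \<integral>x. f x \<partial>gauss_measure"
  shows "(\<integral>x. (\<Sum>n<N. f ((gauss_map ^^ n) x) - m)\<^sup>2 \<partial>gauss_measure) \<le> 3 * real N"
proof (induction N)
  case (Suc N)
  note [measurable] = f(1)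
  define \<psi> where "\<psi> x = f x - m" for x
  define S where "S x = (\<Sum>n<N. \<psi> ((gauss_map ^^ n) x))" for x
  have [measurable]: "\<psi> \<in> borel_measurable borel" unfolding \<psi>_def by measurable
  have [measurable]: "S \<in> borel_measurable borel" unfolding S_def by measurable
  have \<psi>1: "\<bar>\<psi> x\<bar> \<le> 1" for x
  proof -
    have "0 \<le> m" unfolding m_def using f(2) by (intro integral_nonneg_AE) auto
    moreover have "m \<le> (\<integral>x. 1 \<partial>gauss_measure)"
      unfolding m_def using f(2) by (intro integral_mono gauss_integrable[of _ 1]) force+
    ultimately show ?thesis using f(2)[of x] by (auto simp: \<psi>_def abs_if)
  qed
  have SN: "\<bar>S x\<bar> \<le> real N" for x
    unfolding S_def using sum_norm_bound[of "{..<N}" "\<lambda>n. \<psi> ((gauss_map ^^ n) x)" 1] \<psi>1 by simp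
  have i1: "integrable gauss_measure (\<lambda>x. (\<psi> x)\<^sup>2)"
    using \<psi>1 by (intro gauss_integrable[of _ 1]) (auto simp: abs_square_le_1)
  have i2: "integrable gauss_measure (\<lambda>x. \<psi> x * \<psi> ((gauss_map ^^ k) (gauss_map x)))" for k
    using \<psi>1 by (intro gauss_integrable[of _ 1]) (auto simp: abs_mult mult_le_one)
  have i3: "integrable gauss_measure (\<lambda>x. (S (gauss_map x))\<^sup>2)"
    using SN by (intro gauss_integrable[of _ "(real N)\<^sup>2"]) (auto simp: power2_le_iff_abs_le)
  have "(\<integral>x. (\<Sum>n<Suc N. f ((gauss_map ^^ n) x) - m)\<^sup>2 \<partial>gauss_measure) =
      (\<integral>x. (\<psi> x + S (gauss_map x))\<^sup>2 \<partial>gauss_measure)"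
    by (subst sum.lessThan_Suc_shift) (simp add: S_def \<psi>_def funpow_swap1)
  also have "\<dots> = (\<integral>x. (\<psi> x)\<^sup>2 + 2 * (\<Sum>k<N. \<psi> x * \<psi> ((gauss_map ^^ k) (gauss_map x))) +
      (S (gauss_map x))\<^sup>2 \<partial>gauss_measure)"
    by (intro Bochner_Integration.integral_cong)
      (auto simp: power2_sum sum_distrib_left[symmetric] S_def)
  also have "\<dots> = (\<integral>x. (\<psi> x)\<^sup>2 \<partial>gauss_measure) +
      2 * (\<Sum>k<N. \<integral>x. \<psi> x * \<psi> ((gauss_map ^^ k) (gauss_map x)) \<partial>gauss_measure) +
      (\<integral>x. (S (gauss_map x))\<^sup>2 \<partial>gauss_measure)"
    using i1 i2 i3 by simp
  also have "(\<integral>x. (S (gauss_map x))\<^sup>2 \<partial>gauss_measure) = (\<integral>x. (S x)\<^sup>2 \<partial>gauss_measure)"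
    by (intro gauss_integral_invariant) measurable
  also have "\<dots> \<le> 3 * real N" using Suc by (simp add: S_def \<psi>_def)
  also have "(\<integral>x. (\<psi> x)\<^sup>2 \<partial>gauss_measure) \<le> (\<integral>x. 1 \<partial>gauss_measure)"
    using \<psi>1 by (intro integral_mono i1) (auto simp: abs_square_le_1)
  also have "(\<Sum>k<N. \<integral>x. \<psi> x * \<psi> ((gauss_map ^^ k) (gauss_map x)) \<partial>gauss_measure) \<le>
      (\<Sum>k<N. (1 / 2) ^ Suc k)"
    using gauss_correlation[OF f, of "Suc _"]
    by (intro sum_mono) (simp add: \<psi>_def m_def funpow_swap1)
  also have "(\<Sum>k<N. (1 / 2) ^ Suc k) \<le> (1 :: real)"
    by (simp add: sum_distrib_left[symmetric] sum_gp_strict flip: sum_divide_distrib)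
  finally show ?case by simp
qed simp

text \<open>With r the integer part of the square root of N, monotonicity traps \<open>c N\<close>
  between its values at the squares of r and r + 1. Consecutive squares have ratio tending to 1, so
  both bounds have the same limit after division by N.\<close>

lemma tendsto_average_from_squares:
  fixes c :: "nat \<Rightarrow> real"
  assumes mono: "mono c" and c0: "0 \<le> c 0"
    and lim: "(\<lambda>k. c ((Suc k)\<^sup>2) / (real (Suc k))\<^sup>2) \<longlonglongrightarrow> l"
  shows "(\<lambda>N. c N / real N) \<longlonglongrightarrow> l"
proof -
  define r where "r N = nat \<lfloor>sqrt (real N)\<rfloor>" for N
  have r: "filterlim r at_top sequentially"
    unfolding r_def by real_asymp
  have a: "(\<lambda>k. c (k\<^sup>2) / (real k)\<^sup>2) \<longlonglongrightarrow> l"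
    using lim by (rule LIMSEQ_imp_Suc)
  have low: "(\<lambda>k. c (k\<^sup>2) / (real k)\<^sup>2 * ((real k)\<^sup>2 / (real (Suc k))\<^sup>2)) \<longlonglongrightarrow> l * 1"
    by (intro tendsto_mult a) real_asymp
  have up: "(\<lambda>k. c ((Suc k)\<^sup>2) / (real (Suc k))\<^sup>2 * ((real (Suc k))\<^sup>2 / (real k)\<^sup>2)) \<longlonglongrightarrow> l * 1"
    by (intro tendsto_mult lim) real_asymp
  have c: "0 \<le> c N" for N using monoD[OF mono, of 0 N] c0 by simp
  show ?thesis
  proof (rule tendsto_sandwich)
    show "(\<lambda>N. c ((r N)\<^sup>2) / (real (r N))\<^sup>2 * ((real (r N))\<^sup>2 / (real (Suc (r N)))\<^sup>2)) \<longlonglongrightarrow> l"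
      using filterlim_compose[OF low r] by simp
    show "(\<lambda>N. c ((Suc (r N))\<^sup>2) / (real (Suc (r N)))\<^sup>2 * ((real (Suc (r N)))\<^sup>2 / (real (r N))\<^sup>2)) \<longlonglongrightarrow> l"
      using filterlim_compose[OF up r] by simp
    have bounds: "0 < r N \<and> (r N)\<^sup>2 \<le> N \<and> N \<le> (Suc (r N))\<^sup>2" if "0 < N" for N
    proof -
      have s: "1 \<le> sqrt (real N)" using that by simp
      have "real (r N) \<le> sqrt (real N)" "sqrt (real N) \<le> real (Suc (r N))"
        unfolding r_def using s by linarith+
      then have "(real (r N))\<^sup>2 \<le> real N" "real N \<le> (real (Suc (r N)))\<^sup>2"
        using power_mono[of "real (r N)" "sqrt (real N)" 2]
          power_mono[of "sqrt (real N)" "real (Suc (r N))" 2] by simp_all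
      then have "(r N)\<^sup>2 \<le> N" "N \<le> (Suc (r N))\<^sup>2"
        by (simp_all del: of_nat_Suc flip: of_nat_power)
      moreover have "0 < r N" unfolding r_def using s by linarith
      ultimately show ?thesis by blast
    qed
    show "\<forall>\<^sub>F N in sequentially. c ((r N)\<^sup>2) / (real (r N))\<^sup>2 * ((real (r N))\<^sup>2 / (real (Suc (r N)))\<^sup>2) \<le> c N / real N"
      using eventually_gt_at_top[of 0]
    proof eventually_elim
      case (elim N)
      have "c ((r N)\<^sup>2) / (real (Suc (r N)))\<^sup>2 \<le> c N / real N"
        using bounds[OF elim] elim c
        by (intro frac_le monoD[OF mono]) (auto simp del: of_nat_Suc simp flip: of_nat_power)
      then show ?case using bounds[OF elim] by simp
    qed
    show "\<forall>\<^sub>F N in sequentially. c N / real N \<le> c ((Suc (r N))\<^sup>2) / (real (Suc (r N)))\<^sup>2 * ((real (Suc (r N)))\<^sup>2 / (real (r N))\<^sup>2)"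
      using eventually_gt_at_top[of 0]
    proof eventually_elim
      case (elim N)
      have "c N / real N \<le> c ((Suc (r N))\<^sup>2) / (real (r N))\<^sup>2"
        using bounds[OF elim] elim c
        by (intro frac_le monoD[OF mono]) (auto simp del: of_nat_Suc simp flip: of_nat_power)
      then show ?case using bounds[OF elim] by (simp del: of_nat_Suc)
    qed
  qed
qed

text \<open>At time \<open>(Suc k)\<^sup>2\<close> the averaged deviation has second moment at most
  \<open>3 / (real (Suc k))\<^sup>2\<close>. This is summable in k, so the squared deviations have
  an almost surely convergent sum and tend to 0. Squares are sparse enough for the summation and
  dense enough to fill the gaps by monotonicity.\<close>

lemma gauss_slln:
  assumes s: "0 \<le> s" "s \<le> 1"
  shows "AE x in gauss_measure. has_freq (\<lambda>n. (gauss_map ^^ n) x < s) (ln (1 + s) / ln 2)"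
proof -
  define f :: "real \<Rightarrow> real" where "f = indicator {..<s}"
  define m where "m = ln (1 + s) / ln 2"
  have f: "f \<in> borel_measurable borel" "\<And>t. f t \<in> {0..1}" "antimono_on {0..1} f"
    by (auto simp: f_def indicator_def monotone_on_def)
  note [measurable] = f(1)
  have m: "(\<integral>x. f x \<partial>gauss_measure) = m"
    using emeasure_gauss_measure_lessThan[OF s] s by (simp add: f_def measure_def m_def)
  define S where "S N x = (\<Sum>n<N. f ((gauss_map ^^ n) x) - m)" for N x
  have [measurable]: "S N \<in> borel_measurable borel" for N unfolding S_def by measurable
  define q where "q k x = (S ((Suc k)\<^sup>2) x / (real (Suc k))\<^sup>2)\<^sup>2" for k x
  have [measurable]: "q k \<in> borel_measurable borel" for k unfolding q_def by measurable
  have "(\<integral>\<^sup>+x. (\<Sum>k. ennreal (q k x)) \<partial>gauss_measure) = (\<Sum>k. \<integral>\<^sup>+x. ennreal (q k x) \<partial>gauss_measure)"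
    by (intro nn_integral_suminf) measurable
  also have "\<dots> \<le> (\<Sum>k. ennreal (3 / (real (Suc k))\<^sup>2))"
  proof (intro suminf_le)
    fix k
    have m01: "\<bar>m\<bar> \<le> 1"
      using s by (simp add: m_def)
    have "\<bar>S N x\<bar> \<le> real N * 2" for N x
      unfolding S_def
      using sum_norm_bound[of "{..<N}" "\<lambda>n. f ((gauss_map ^^ n) x) - m" 2] f(2) m01
      by (auto simp: abs_if f_def indicator_def split: if_splits)
    then have "\<bar>(S N x)\<^sup>2\<bar> \<le> (real N * 2)\<^sup>2" for N x
      unfolding power_abs by (intro power_mono) auto
    then have i: "integrable gauss_measure (\<lambda>x. (S N x)\<^sup>2)" for N
      by (intro gauss_integrable) auto
    have "(\<integral>\<^sup>+x. ennreal (q k x) \<partial>gauss_measure) = ennreal (\<integral>x. q k x \<partial>gauss_measure)"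
      unfolding q_def power_divide using i by (intro nn_integral_eq_integral) auto
    also have "(\<integral>x. q k x \<partial>gauss_measure) = (\<integral>x. (S ((Suc k)\<^sup>2) x)\<^sup>2 \<partial>gauss_measure) / ((real (Suc k))\<^sup>2)\<^sup>2"
      unfolding q_def power_divide by simp
    also have "\<dots> \<le> 3 * real ((Suc k)\<^sup>2) / ((real (Suc k))\<^sup>2)\<^sup>2"
      using gauss_second_moment[OF f, of "(Suc k)\<^sup>2"] unfolding m S_def
      by (intro divide_right_mono) auto
    also have "\<dots> = 3 / (real (Suc k))\<^sup>2"
      by (simp only: of_nat_power) (simp add: power2_eq_square del: of_nat_Suc)
    finally show "(\<integral>\<^sup>+x. ennreal (q k x) \<partial>gauss_measure) \<le> ennreal (3 / (real (Suc k))\<^sup>2)"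
      by (simp add: ennreal_leI)
  qed auto
  also have "\<dots> = ennreal (\<Sum>k. 3 / (real (Suc k))\<^sup>2)"
  proof (intro suminf_ennreal2)
    have "summable (\<lambda>k. inverse ((real (Suc k))\<^sup>2))"
      using inverse_power_summable[of 2, where 'a = real] by (subst summable_Suc_iff) simp
    from summable_mult[OF this, of 3] show "summable (\<lambda>k. 3 / (real (Suc k))\<^sup>2)"
      by (simp only: divide_inverse)
  qed auto
  also have "\<dots> < \<infinity>" by simp
  \<comment> \<open>A nonnegative function with finite integral is finite almost everywhere; this
    takes the place of a Borel-Cantelli argument.\<close>
  finally have "AE x in gauss_measure. (\<Sum>k. ennreal (q k x)) \<noteq> \<infinity>"
    by (intro nn_integral_PInf_AE) auto
  then show ?thesis
  proof eventually_elim
    case (elim x)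
    then have "summable (\<lambda>k. q k x)"
      by (intro summable_suminf_not_top) (auto simp: q_def)
    then have "(\<lambda>k. sqrt (q k x)) \<longlonglongrightarrow> sqrt 0"
      by (intro tendsto_real_sqrt summable_LIMSEQ_zero)
    then have S0: "(\<lambda>k. S ((Suc k)\<^sup>2) x / (real (Suc k))\<^sup>2) \<longlonglongrightarrow> 0"
      unfolding q_def real_sqrt_abs real_sqrt_zero by (rule tendsto_rabs_zero_cancel)
    define c where "c N = real (card {n. n < N \<and> (gauss_map ^^ n) x < s})" for N
    have "S N x = c N - real N * m" for N
      unfolding S_def c_def card_eq_sum_of_bool
      by (simp add: sum_subtractf f_def indicator_def of_bool_def)
    then have "S ((Suc k)\<^sup>2) x / (real (Suc k))\<^sup>2 = c ((Suc k)\<^sup>2) / (real (Suc k))\<^sup>2 - m" for k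
      by (simp add: diff_divide_distrib del: of_nat_Suc)
    with tendsto_add[OF S0 tendsto_const[of m]]
    have "(\<lambda>k. c ((Suc k)\<^sup>2) / (real (Suc k))\<^sup>2) \<longlonglongrightarrow> m" by simp
    then show ?case
      unfolding has_freq_def c_def[symmetric] m_def[symmetric]
      by (rule tendsto_average_from_squares[rotated 2])
        (auto simp: c_def mono_def intro!: card_mono)
  qed
qed

section \<open>Frequencies of corners\<close>

lemma has_freq_False: "has_freq (\<lambda>n. False) 0"
  by (simp add: has_freq_def)

text \<open>Having a frequency is not stable under conjunction, so the frequency of the overlap has
  to be supplied. The same condition later calls for a family of sets closed under
  intersection.\<close>

lemma has_freq_disj:
  assumes "has_freq P p" "has_freq Q q" "has_freq (\<lambda>n. P n \<and> Q n) r"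
  shows "has_freq (\<lambda>n. P n \<or> Q n) (p + q - r)"
proof -
  have "real (card {n. n < N \<and> (P n \<or> Q n)}) = real (card {n. n < N \<and> P n}) +
      real (card {n. n < N \<and> Q n}) - real (card {n. n < N \<and> P n \<and> Q n})" for N
    unfolding card_eq_sum_of_bool sum.distrib[symmetric] sum_subtractf[symmetric]
    by (intro sum.cong) auto
  then show ?thesis
    using tendsto_diff[OF tendsto_add[OF assms(1,2)[unfolded has_freq_def]] assms(3)[unfolded has_freq_def]]
    unfolding has_freq_def by (simp only: add_divide_distrib diff_divide_distrib)
qed

lemma has_freq_diff:
  assumes "has_freq P p" "has_freq Q q" "\<And>n. Q n \<Longrightarrow> P n"
  shows "has_freq (\<lambda>n. P n \<and> \<not> Q n) (p - q)"
proof -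
  have "real (card {n. n < N \<and> P n \<and> \<not> Q n}) =
      real (card {n. n < N \<and> P n}) - real (card {n. n < N \<and> Q n})" for N
    unfolding card_eq_sum_of_bool sum_subtractf[symmetric]
    using assms(3) by (intro sum.cong) auto
  then show ?thesis
    using tendsto_diff[OF assms(1,2)[unfolded has_freq_def]]
    unfolding has_freq_def by (simp only: diff_divide_distrib)
qed

text \<open>A shift of time changes every count by at most one, which disappears after division by
  N. This allows conditions on the image under \<open>T\<close> to be counted as conditions on the
  point before it.\<close>

lemma has_freq_Suc: "has_freq (\<lambda>n. P (Suc n)) l \<longleftrightarrow> has_freq P l"
proof -
  define c where "c P N = real (card {n. n < N \<and> P n})" for P and N :: nat
  have c: "c P (Suc N) = of_bool (P 0) + c (\<lambda>n. P (Suc n)) N" for N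
    unfolding c_def card_eq_sum_of_bool by (rule sum.lessThan_Suc_shift)
  have lim: "(\<lambda>N. real (Suc N) / real N) \<longlonglongrightarrow> 1" "(\<lambda>N. real N / real (Suc N)) \<longlonglongrightarrow> 1"
    "(\<lambda>N. b / real (Suc N)) \<longlonglongrightarrow> 0" "(\<lambda>N. b / real N) \<longlonglongrightarrow> 0" for b :: real
    by real_asymp+
  show ?thesis
  proof
    assume "has_freq (\<lambda>n. P (Suc n)) l"
    then have "(\<lambda>N. c (\<lambda>n. P (Suc n)) N / real N) \<longlonglongrightarrow> l"
      by (simp add: has_freq_def c_def)
    from tendsto_add[OF lim(3)[of "of_bool (P 0)"] tendsto_mult[OF this lim(2)]]
    have "(\<lambda>N. of_bool (P 0) / real (Suc N) + c (\<lambda>n. P (Suc n)) N / real N * (real N / real (Suc N))) \<longlonglongrightarrow> l"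
      by simp
    moreover have "\<forall>\<^sub>F N in sequentially.
      of_bool (P 0) / real (Suc N) + c (\<lambda>n. P (Suc n)) N / real N * (real N / real (Suc N)) = c P (Suc N) / real (Suc N)"
      using eventually_gt_at_top[of 0] by eventually_elim (simp add: c add_divide_distrib)
    ultimately have "(\<lambda>N. c P (Suc N) / real (Suc N)) \<longlonglongrightarrow> l"
      by (rule Lim_transform_eventually)
    then show "has_freq P l"
      unfolding has_freq_def c_def by (rule LIMSEQ_imp_Suc)
  next
    assume "has_freq P l"
    then have "(\<lambda>N. c P (Suc N) / real (Suc N)) \<longlonglongrightarrow> l"
      unfolding has_freq_def c_def by (rule LIMSEQ_Suc)
    from tendsto_diff[OF tendsto_mult[OF this lim(1)] lim(4)[of "of_bool (P 0)"]]
    have "(\<lambda>N. c P (Suc N) / real (Suc N) * (real (Suc N) / real N) - of_bool (P 0) / real N) \<longlonglongrightarrow> l"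
      by simp
    moreover have "\<forall>\<^sub>F N in sequentially.
      c P (Suc N) / real (Suc N) * (real (Suc N) / real N) - of_bool (P 0) / real N = c (\<lambda>n. P (Suc n)) N / real N"
      using eventually_gt_at_top[of 0]
      by eventually_elim (simp add: c del: of_nat_Suc flip: diff_divide_distrib)
    ultimately have "(\<lambda>N. c (\<lambda>n. P (Suc n)) N / real N) \<longlonglongrightarrow> l"
      by (rule Lim_transform_eventually)
    then show "has_freq (\<lambda>n. P (Suc n)) l"
      by (simp add: has_freq_def c_def)
  qed
qed

text \<open>A set of full measure in \<open>Omega\<close> that \<open>T\<close> maps into itself and
  that contains no point on a horizontal or vertical line with rational coordinate. In particular
  its orbits never reach x = 0.\<close>

definition irrational_Omega :: "(real \<times> real) set" where
  "irrational_Omega = Omega \<inter> (- \<rat>) \<times> (- \<rat>)"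

text \<open>Restricting s to rationals makes this a countable conjunction of almost sure
  statements.\<close>

definition equidist :: "real \<Rightarrow> bool" where
  "equidist x \<longleftrightarrow> (\<forall>s\<in>\<rat> \<inter> {0..1}. has_freq (\<lambda>n. (gauss_map ^^ n) x < s) (ln (1 + s) / ln 2))"

lemma T_irrational_Omega:
  assumes "z \<in> irrational_Omega"
  shows "T z \<in> irrational_Omega"
proof -
  obtain x y where z: "z = (x, y)" "0 < x" "x < 1" "y < -1" "x \<notin> \<rat>" "y \<notin> \<rat>"
    using assms by (cases z) (auto simp: irrational_Omega_def Omega_def)
  have inv: "1 / u - of_int k \<notin> \<rat>" if "u \<notin> \<rat>" for u :: real and k
  proof
    assume "1 / u - of_int k \<in> \<rat>"
    then have "inverse (1 / u - of_int k + of_int k) \<in> \<rat>"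
      by (intro Rats_inverse Rats_add) auto
    with that show False by simp
  qed
  have "1 / x - of_int \<lfloor>1 / x\<rfloor> \<noteq> 0" using inv[of x "\<lfloor>1 / x\<rfloor>"] z Rats_0 by metis
  then have "0 < 1 / x - of_int \<lfloor>1 / x\<rfloor>" by linarith
  moreover have "1 / x - of_int \<lfloor>1 / x\<rfloor> < 1" by linarith
  moreover have "1 / y - of_int \<lfloor>1 / x\<rfloor> < -1"
  proof -
    have "1 \<le> \<lfloor>1 / x\<rfloor>" using z by (simp add: le_floor_iff)
    then have "1 \<le> (of_int \<lfloor>1 / x\<rfloor> :: real)" by simp
    moreover have "1 / y < 0" using z by simp
    ultimately show ?thesis by linarith
  qed
  ultimately show ?thesis
    using inv z by (simp add: irrational_Omega_def Omega_def T_def)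
qed

lemma T_funpow_irrational_Omega: "z \<in> irrational_Omega \<Longrightarrow> (T ^^ n) z \<in> irrational_Omega"
  by (induction n) (auto intro: T_irrational_Omega)

lemma fst_T_funpow: "fst ((T ^^ n) z) = (gauss_map ^^ n) (fst z)"
  by (induction n) (auto simp: T_def gauss_map_def frac_def split: prod.splits)

text \<open>\<open>T\<close> maps \<open>{1 / (b + s) < x < 1 / b, y < - 1 / \<theta>}\<close> onto the strip \<open>{x < s, - b - \<theta> < y < - b}\<close>,
  up to points with a rational coordinate.\<close>

lemma T_strip:
  assumes z: "z \<in> irrational_Omega" and "1 \<le> b" "0 < \<theta>" "\<theta> \<le> 1" "0 \<le> s" "s \<le> 1"
  shows "fst (T z) < s \<and> - (real b + \<theta>) < snd (T z) \<and> snd (T z) < - real b \<longleftrightarrow>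
    1 / (real b + s) < fst z \<and> fst z < 1 / real b \<and> snd z < - (1 / \<theta>)"
proof -
  obtain x y where xy: "z = (x, y)" "0 < x" "x < 1" "y < -1"
    using z by (cases z) (auto simp: irrational_Omega_def Omega_def)
  define a where "a = \<lfloor>1 / x\<rfloor>"
  have a: "of_int a \<le> 1 / x" "1 / x < of_int a + 1" unfolding a_def by linarith+
  have Tz: "T z = (1 / x - of_int a, 1 / y - of_int a)" by (simp add: T_def xy a_def)
  have y1: "-1 < 1 / y" "1 / y < 0" using xy by (auto simp: field_simps)
  have yt: "- \<theta> < 1 / y \<longleftrightarrow> y < - (1 / \<theta>)"
    using neg_less_divide_eq[of y "- \<theta>" 1] pos_divide_less_eq[of \<theta> 1 "- y"] xy \<open>0 < \<theta>\<close>
    by (auto simp: mult.commute)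
  have xb: "1 / (real b + s) < x \<longleftrightarrow> 1 / x < real b + s" "x < 1 / real b \<longleftrightarrow> real b < 1 / x"
    using pos_divide_less_eq[of "real b + s" 1 x] pos_divide_less_eq[of x 1 "real b + s"]
      pos_less_divide_eq[of "real b" x 1] pos_less_divide_eq[of x "real b" 1] xy \<open>1 \<le> b\<close> \<open>0 \<le> s\<close>
    by (auto simp: mult.commute)
  \<comment> \<open>The integer part only gives a weak inequality between b and 1/x; irrationality
    of x makes it strict.\<close>
  have xirr: "1 / x \<noteq> real b"
  proof
    assume "1 / x = real b"
    from this[symmetric] have "x = 1 / real b" by simp
    then have "x \<in> \<rat>" by simp
    with z xy show False by (simp add: irrational_Omega_def)
  qed
  \<comment> \<open>Either side of the equivalence forces the removed digit to be b: on the left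
    because 1/y lies in (-1, 0) and \<theta> \<le> 1, on the right because s \<le> 1.\<close>
  have ab: "a = int b" if "real b < of_int a + 1" "of_int a < real b + 1"
    using that by linarith
  have "1 / x - of_int a < s \<and> - (real b + \<theta>) < 1 / y - of_int a \<and> 1 / y - of_int a < - real b \<longleftrightarrow>
      1 / x < real b + s \<and> real b < 1 / x \<and> - \<theta> < 1 / y" (is "?l \<longleftrightarrow> ?r")
  proof
    assume ?l
    then have "a = int b" using y1 assms by (intro ab) linarith+
    with \<open>?l\<close> a xirr show ?r by auto
  next
    assume ?r
    then have "a = int b" using a assms by (intro ab) linarith+
    with \<open>?r\<close> y1 show ?l by auto
  qed
  then show ?thesis unfolding Tz using xb yt xy(1) by simp
qed

text \<open>\<open>ln (1 + s / c)\<close> is the integral of \<open>1 / (x - y)\<^sup>2\<close> over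
  0 < x < s, y < -c, and \<open>ln 2\<close> is the integral over all of
  \<open>Omega\<close>.\<close>

definition corner_freq :: "real \<times> real \<Rightarrow> real \<Rightarrow> bool" where
  "corner_freq z c \<longleftrightarrow> (\<forall>s\<in>\<rat> \<inter> {0..1}.
    has_freq (\<lambda>n. fst ((T ^^ n) z) < s \<and> snd ((T ^^ n) z) < - c) (ln (1 + s / c) / ln 2))"

text \<open>The corner at b + \<theta> is the corner at b minus a strip. One step earlier, the strip
  is the corner x < 1/b, y < -1/\<theta> minus the corner x < 1/(b + s), y < -1/\<theta>, both known
  from the hypothesis at 1/\<theta>.\<close>

lemma corner_freq_step:
  assumes z: "z \<in> irrational_Omega" and b: "1 \<le> b" and \<theta>: "0 < \<theta>" "\<theta> \<le> 1" "\<theta> \<in> \<rat>"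
    and fb: "corner_freq z (real b)" and ft: "corner_freq z (1 / \<theta>)"
  shows "corner_freq z (real b + \<theta>)"
  unfolding corner_freq_def
proof
  fix s :: real assume s: "s \<in> \<rat> \<inter> {0..1}"
  define X where "X n = fst ((T ^^ n) z)" for n
  define Y where "Y n = snd ((T ^^ n) z)" for n
  have irr: "X n \<notin> \<rat>" "Y n \<notin> \<rat>" for n
    using T_funpow_irrational_Omega[OF z, of n] by (auto simp: irrational_Omega_def X_def Y_def)
  have b1: "1 / real b \<in> \<rat> \<inter> {0..1}" "1 / (real b + s) \<in> \<rat> \<inter> {0..1}"
    using b s by (auto simp: pos_divide_le_eq intro!: Rats_divide divide_nonneg_nonneg)
  have le: "1 / (real b + s) \<le> 1 / real b"
    using b s by (intro divide_left_mono) auto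
  have f: "has_freq (\<lambda>n. X n < t \<and> Y n < - (1 / \<theta>)) (ln (1 + t / (1 / \<theta>)) / ln 2)" if "t \<in> \<rat> \<inter> {0..1}" for t
    using ft that unfolding corner_freq_def X_def Y_def by blast
  have "has_freq (\<lambda>n. (X n < 1 / real b \<and> Y n < - (1 / \<theta>)) \<and> \<not> (X n < 1 / (real b + s) \<and> Y n < - (1 / \<theta>)))
      (ln (1 + (1 / real b) / (1 / \<theta>)) / ln 2 - ln (1 + (1 / (real b + s)) / (1 / \<theta>)) / ln 2)"
    using le by (intro has_freq_diff[OF f f] b1) linarith
  moreover have "((X n < 1 / real b \<and> Y n < - (1 / \<theta>)) \<and> \<not> (X n < 1 / (real b + s) \<and> Y n < - (1 / \<theta>))) \<longleftrightarrow>
      X (Suc n) < s \<and> - (real b + \<theta>) < Y (Suc n) \<and> Y (Suc n) < - real b" for n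
  proof -
    have "X n \<noteq> 1 / (real b + s)" using irr(1)[of n] b1 by auto
    then have "((X n < 1 / real b \<and> Y n < - (1 / \<theta>)) \<and> \<not> (X n < 1 / (real b + s) \<and> Y n < - (1 / \<theta>))) \<longleftrightarrow>
      1 / (real b + s) < X n \<and> X n < 1 / real b \<and> Y n < - (1 / \<theta>)" by auto
    also have "\<dots> \<longleftrightarrow> X (Suc n) < s \<and> - (real b + \<theta>) < Y (Suc n) \<and> Y (Suc n) < - real b"
      unfolding X_def Y_def using T_strip[OF T_funpow_irrational_Omega[OF z, of n] b \<theta>(1,2), of s] s by simp
    finally show ?thesis .
  qed
  ultimately have "has_freq (\<lambda>n. X (Suc n) < s \<and> - (real b + \<theta>) < Y (Suc n) \<and> Y (Suc n) < - real b)
      (ln (1 + (1 / real b) / (1 / \<theta>)) / ln 2 - ln (1 + (1 / (real b + s)) / (1 / \<theta>)) / ln 2)"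
    by simp
  then have strip: "has_freq (\<lambda>n. X n < s \<and> - (real b + \<theta>) < Y n \<and> Y n < - real b)
      (ln (1 + (1 / real b) / (1 / \<theta>)) / ln 2 - ln (1 + (1 / (real b + s)) / (1 / \<theta>)) / ln 2)"
    by (rule has_freq_Suc[THEN iffD1])
  have "has_freq (\<lambda>n. X n < s \<and> Y n < - real b) (ln (1 + s / real b) / ln 2)"
    using fb s by (simp add: corner_freq_def X_def Y_def)
  from has_freq_diff[OF this strip]
  have "has_freq (\<lambda>n. (X n < s \<and> Y n < - real b) \<and> \<not> (X n < s \<and> - (real b + \<theta>) < Y n \<and> Y n < - real b))
    (ln (1 + s / real b) / ln 2 -
      (ln (1 + (1 / real b) / (1 / \<theta>)) / ln 2 - ln (1 + (1 / (real b + s)) / (1 / \<theta>)) / ln 2))"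
    by blast
  moreover have "((X n < s \<and> Y n < - real b) \<and> \<not> (X n < s \<and> - (real b + \<theta>) < Y n \<and> Y n < - real b)) \<longleftrightarrow>
      X n < s \<and> Y n < - (real b + \<theta>)" for n
  proof -
    have "- (real b + \<theta>) \<in> \<rat>" using \<theta> by simp
    then have "Y n \<noteq> - (real b + \<theta>)" using irr(2)[of n] by metis
    then show ?thesis using \<theta> by auto
  qed
  \<comment> \<open>Written as quotients, the arguments of the logarithms have the factors b and b +
    s in common; these cancel and leave (b + s + \<theta>)/(b + \<theta>).\<close>
  moreover have "ln (1 + s / real b) / ln 2 -
      (ln (1 + (1 / real b) / (1 / \<theta>)) / ln 2 - ln (1 + (1 / (real b + s)) / (1 / \<theta>)) / ln 2) =
      ln (1 + s / (real b + \<theta>)) / ln 2"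
  proof -
    have pos: "0 < real b" "0 \<le> s" using b s by auto
    then have p: "0 < real b + s" "0 < real b + \<theta>" "0 < real b + \<theta> + s" "0 < real b + s + \<theta>"
      using \<theta> by auto
    have g: "1 + u / d = (d + u) / d" if "0 < d" for u d :: real
      using that by (simp add: field_simps)
    have e: "1 + s / real b = (real b + s) / real b"
      "1 + (1 / real b) / (1 / \<theta>) = (real b + \<theta>) / real b"
      "1 + (1 / (real b + s)) / (1 / \<theta>) = (real b + s + \<theta>) / (real b + s)"
      "1 + s / (real b + \<theta>) = (real b + s + \<theta>) / (real b + \<theta>)"
      using pos p by (simp_all add: g ac_simps)
    show ?thesis
      unfolding e using pos p
      by (simp add: ln_div diff_divide_distrib)
  qed
  ultimately show "has_freq (\<lambda>n. fst ((T ^^ n) z) < s \<and> snd ((T ^^ n) z) < - (real b + \<theta>))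
      (ln (1 + s / (real b + \<theta>)) / ln 2)"
    by (simp add: X_def Y_def)
qed

lemma corner_freq_one:
  assumes z: "z \<in> irrational_Omega" and eq: "equidist (fst z)"
  shows "corner_freq z 1"
proof -
  \<comment> \<open>For c = 1 the condition on y holds along the whole orbit, so only the Gauss map
    is left.\<close>
  have "snd ((T ^^ n) z) < -1" for n
    using T_funpow_irrational_Omega[OF z, of n] by (auto simp: irrational_Omega_def Omega_def)
  then show ?thesis
    using eq by (simp add: corner_freq_def equidist_def fst_T_funpow)
qed

text \<open>The step is taken with \<theta> = 1, where 1/\<theta> is again the base case c =
  1.\<close>

lemma corner_freq_nat:
  assumes z: "z \<in> irrational_Omega" and eq: "equidist (fst z)"
  shows "corner_freq z (real (Suc b))"
proof (induction b)
  case 0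
  then show ?case using corner_freq_one[OF assms] by simp
next
  case (Suc b)
  have "corner_freq z (real (Suc b) + 1)"
    using corner_freq_one[OF assms] by (intro corner_freq_step z Suc) auto
  then show ?case by (simp add: add.commute)
qed

text \<open>With p = b q + r the fraction is b + r/q, so the step needs the integer corner b and the
  corner q/r. The latter has the smaller denominator r, whence the strong induction on q for
  arbitrary p; r = 0 leaves an integer.\<close>

lemma corner_freq_fraction:
  assumes z: "z \<in> irrational_Omega" and eq: "equidist (fst z)" and "1 \<le> q" "q \<le> p"
  shows "corner_freq z (real p / real q)"
  using assms(3,4)
proof (induction q arbitrary: p rule: less_induct)
  case (less q)
  define b where "b = p div q"
  define r where "r = p mod q"
  have p: "p = b * q + r" by (simp add: b_def r_def)
  have b: "1 \<le> b" using less.prems by (simp add: b_def div_greater_zero_iff Suc_le_eq)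
  have r: "r < q" using less.prems by (simp add: r_def)
  have pq: "real p / real q = real b + real r / real q"
    using less.prems by (simp add: p field_simps)
  have fb: "corner_freq z (real b)"
    using corner_freq_nat[OF z eq, of "b - 1"] b by simp
  show ?case
  proof (cases "r = 0")
    case True
    then show ?thesis using fb pq by simp
  next
    case False
    then have "corner_freq z (real q / real r)" using less.IH[of r q] r by simp
    then show ?thesis
      unfolding pq using b r False less.prems by (intro corner_freq_step z fb) auto
  qed
qed

lemma corner_freq_Rats:
  assumes z: "z \<in> irrational_Omega" and eq: "equidist (fst z)" and c: "c \<in> \<rat>" "1 \<le> c"
  shows "corner_freq z c"
proof -
  obtain p q :: nat where "q \<noteq> 0" "\<bar>c\<bar> = real p / real q"
    using Rats_abs_nat_div_natE[OF c(1)] by metis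
  then have "c = real p / real q" "1 \<le> q" using c by auto
  moreover have "real q \<le> real p" using calculation c(2) by (simp add: pos_le_divide_eq)
  ultimately show ?thesis using corner_freq_fraction[OF z eq] by simp
qed

section \<open>Equidistribution in \<open>Omega\<close>\<close>

text \<open>Left unnormalised, with total mass \<open>ln 2\<close>: then
  \<open>c_norm \<alpha>\<close> is the inverse of the measure of \<open>Omega_sub \<alpha>\<close>,
  and the factor \<open>ln 2\<close> cancels in quotients of frequencies.\<close>

definition Omega_measure :: "(real \<times> real) measure" where
  "Omega_measure = density lborel (\<lambda>(x, y). ennreal (indicator Omega (x, y) / (x - y)\<^sup>2))"

lemma open_Omega: "open Omega"
  unfolding Omega_def by (intro open_Times) auto

lemma Omega_borel [measurable]: "Omega \<in> sets borel"
  by (simp add: open_Omega)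

lemma sets_Omega_measure [simp, measurable_cong]: "sets Omega_measure = sets borel"
  and space_Omega_measure [simp]: "space Omega_measure = UNIV"
  by (simp_all add: Omega_measure_def)

lemma Omega_density_measurable [measurable]:
  "(\<lambda>(x, y). indicator Omega (x, y) / (x - y)\<^sup>2 :: real) \<in> borel_measurable borel"
  unfolding borel_prod[symmetric] by measurable

lemma Omega_density_measurable' [measurable]:
  "(\<lambda>(x, y). ennreal (indicator Omega (x, y) / (x - y)\<^sup>2)) \<in> borel_measurable borel"
  using measurable_compose[OF Omega_density_measurable measurable_ennreal] by (simp add: case_prod_beta')

lemma AE_lborel_fst:
  assumes "AE x in (lborel :: real measure). P x"
  shows "AE z in (lborel :: (real \<times> real) measure). P (fst z)"
proof -
  obtain N where N: "{x. \<not> P x} \<subseteq> N" "N \<in> null_sets lborel"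
    using assms by (auto simp: eventually_ae_filter)
  have "N \<times> UNIV \<in> null_sets (lborel :: (real \<times> real) measure)"
    using lborel.times_in_null_sets1[OF N(2), of UNIV] by (simp add: lborel_prod)
  then show ?thesis
    by (rule AE_I') (use N in auto)
qed

lemma AE_lborel_snd:
  assumes "AE x in (lborel :: real measure). P x"
  shows "AE z in (lborel :: (real \<times> real) measure). P (snd z)"
proof -
  obtain N where N: "{x. \<not> P x} \<subseteq> N" "N \<in> null_sets lborel"
    using assms by (auto simp: eventually_ae_filter)
  have "UNIV \<times> N \<in> null_sets (lborel :: (real \<times> real) measure)"
    using lborel.times_in_null_sets2[OF _ N(2), of UNIV lborel] by (simp add: lborel_prod)
  then show ?thesis
    by (rule AE_I') (use N in auto)
qed

lemma AE_irrational_Omega: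
  "AE z in lborel. z \<in> Omega \<longrightarrow> z \<in> irrational_Omega"
proof -
  have "AE x in lborel. (x :: real) \<notin> \<rat>"
    by (intro AE_not_in countable_imp_null_set_lborel countable_rat)
  from AE_lborel_fst[OF this] AE_lborel_snd[OF this] show ?thesis
    by eventually_elim (auto simp: irrational_Omega_def)
qed

text \<open>The exceptional condition concerns x only, so a null set on the line gives a null
  cylinder in the plane.\<close>

lemma AE_equidist:
  "AE z in (lborel :: (real \<times> real) measure). z \<in> Omega \<longrightarrow> equidist (fst z)"
proof -
  have "AE x in gauss_measure. equidist x"
    unfolding equidist_def using gauss_slln countable_rat
    by (subst AE_ball_countable) (auto intro: countable_subset[of _ "\<rat> :: real set"])
  from AE_lborel_fst[OF this[unfolded AE_gauss_measure_iff]] show ?thesis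
    by eventually_elim (auto simp: Omega_def)
qed

lemma AE_Omega_measure_iff:
  "(AE z in Omega_measure. P z) \<longleftrightarrow> (AE z in lborel. z \<in> Omega \<longrightarrow> P z)"
  unfolding Omega_measure_def
proof (subst AE_density)
  have "0 < (case z of (x, y) \<Rightarrow> ennreal (indicator Omega (x, y) / (x - y)\<^sup>2)) \<longleftrightarrow> z \<in> Omega" for z
  proof (cases "z \<in> Omega")
    case True
    then show ?thesis by (auto simp: Omega_def)
  next
    case False
    then show ?thesis by (auto split: prod.splits)
  qed
  then show "(AE z in lborel. 0 < (case z of (x, y) \<Rightarrow> ennreal (indicator Omega (x, y) / (x - y)\<^sup>2)) \<longrightarrow> P z) \<longleftrightarrow>
      (AE z in lborel. z \<in> Omega \<longrightarrow> P z)"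
    by simp
qed simp

lemma AE_Omega_measure_irrational: "AE z in Omega_measure. z \<in> irrational_Omega"
  using AE_irrational_Omega by (simp add: AE_Omega_measure_iff)

text \<open>Integrating over y leaves 1/(x + c), and then a logarithm. Up to the factor
  \<open>ln 2\<close> these are the numbers in \<open>corner_freq\<close>; the agreement on corners
  is what identifies the limiting distribution.\<close>

lemma emeasure_Omega_corner:
  assumes s: "0 \<le> s" "s \<le> 1" and c: "1 \<le> c"
  shows "emeasure Omega_measure {z. fst z < s \<and> snd z < - c} = ennreal (ln (1 + s / c))"
proof -
  have inner: "(\<integral>\<^sup>+y. ennreal (1 / (x - y)\<^sup>2) * indicator {..<- c} y \<partial>lborel) = ennreal (1 / (x + c))"
    if x: "0 < x" for x
  proof -
    have "(\<integral>\<^sup>+y. ennreal (1 / (x - y)\<^sup>2) * indicator {..<- c} y \<partial>lborel) =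
        (\<integral>\<^sup>+y. ennreal (1 / (x + y)\<^sup>2) * indicator {..<- c} (- y) \<partial>lborel)"
      by (subst nn_integral_real_affine[where c = "-1" and t = 0]) auto
    also have "\<dots> = (\<integral>\<^sup>+y. ennreal (1 / (x + y)\<^sup>2) * indicator {c..} y \<partial>lborel)"
      by (intro nn_integral_cong_AE, use AE_lborel_singleton[of c] in eventually_elim)
        (auto simp: indicator_def)
    also have "\<dots> = ennreal (0 - (- 1 / (x + c)))"
    proof (rule nn_integral_FTC_atLeast)
      show "((\<lambda>y. - 1 / (x + y)) has_real_derivative 1 / (x + y)\<^sup>2) (at y)" if "c \<le> y" for y
        using x c that by (auto intro!: derivative_eq_intros simp: power2_eq_square)
      show "((\<lambda>y. - 1 / (x + y)) \<longlongrightarrow> 0) at_top" by real_asymp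
    qed auto
    finally show ?thesis by simp
  qed
  have "emeasure Omega_measure {z. fst z < s \<and> snd z < - c} =
      (\<integral>\<^sup>+z. (\<lambda>(x, y). ennreal (indicator Omega (x, y) / (x - y)\<^sup>2)) z *
        indicator {z. fst z < s \<and> snd z < - c} z \<partial>lborel)"
    unfolding Omega_measure_def by (intro emeasure_density) (auto intro!: borel_open open_Collect_conj open_Collect_less continuous_intros)
  also have "\<dots> = (\<integral>\<^sup>+x. \<integral>\<^sup>+y. (indicator {0<..<s} x * (ennreal (1 / (x - y)\<^sup>2) * indicator {..<- c} y)) \<partial>lborel \<partial>lborel)"
  proof -
    have "(\<integral>\<^sup>+z. (\<lambda>(x, y). ennreal (indicator Omega (x, y) / (x - y)\<^sup>2)) z *
        indicator {z. fst z < s \<and> snd z < - c} z \<partial>lborel) =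
      (\<integral>\<^sup>+z. (\<lambda>(x, y). indicator {0<..<s} x * (ennreal (1 / (x - y)\<^sup>2) * indicator {..<- c} y)) z \<partial>(lborel \<Otimes>\<^sub>M lborel))"
      unfolding lborel_prod using s c by (intro nn_integral_cong) (auto simp: indicator_def Omega_def)
    also have "\<dots> = (\<integral>\<^sup>+x. \<integral>\<^sup>+y. (indicator {0<..<s} x * (ennreal (1 / (x - y)\<^sup>2) * indicator {..<- c} y)) \<partial>lborel \<partial>lborel)"
      by (subst lborel.nn_integral_fst[symmetric]) auto
    finally show ?thesis .
  qed
  also have "\<dots> = (\<integral>\<^sup>+x. ennreal (1 / (x + c)) * indicator {0..s} x \<partial>lborel)"
  proof (rule nn_integral_cong_AE)
    show "AE x in lborel. (\<integral>\<^sup>+y. indicator {0<..<s} x * (ennreal (1 / (x - y)\<^sup>2) * indicator {..<- c} y) \<partial>lborel) =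
        ennreal (1 / (x + c)) * indicator {0..s} x"
      using AE_lborel_singleton[of 0] AE_lborel_singleton[of s]
    proof eventually_elim
      case (elim x)
      have "(\<integral>\<^sup>+y. indicator {0<..<s} x * (ennreal (1 / (x - y)\<^sup>2) * indicator {..<- c} y) \<partial>lborel) =
          indicator {0<..<s} x * (\<integral>\<^sup>+y. ennreal (1 / (x - y)\<^sup>2) * indicator {..<- c} y \<partial>lborel)"
        by (intro nn_integral_cmult) auto
      then show ?case
        using elim inner by (cases "x \<in> {0<..<s}") auto
    qed
  qed
  also have "\<dots> = ennreal (ln (s + c) - ln (0 + c))"
    using s c by (intro nn_integral_FTC_Icc[where F = "\<lambda>x. ln (x + c)"]) (auto intro!: derivative_eq_intros)
  also have "ln (s + c) - ln (0 + c) = ln (1 + s / c)"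
  proof -
    have "1 + s / c = (s + c) / c" using c by (simp add: field_simps)
    then show ?thesis using s c by (simp add: ln_div)
  qed
  finally show ?thesis .
qed

lemma emeasure_Omega_measure_UNIV: "emeasure Omega_measure UNIV = ennreal (ln 2)"
proof -
  have "emeasure Omega_measure UNIV = emeasure Omega_measure {z. fst z < 1 \<and> snd z < - 1}"
    by (intro emeasure_eq_AE) (auto simp: AE_Omega_measure_iff Omega_def
        intro!: borel_open open_Collect_conj open_Collect_less continuous_intros)
  also have "\<dots> = ennreal (ln (1 + 1 / 1))" by (rule emeasure_Omega_corner) auto
  finally show ?thesis by simp
qed

interpretation Om: finite_measure Omega_measure
  by (rule finite_measureI) (simp add: emeasure_Omega_measure_UNIV)

lemma measure_Omega_measure_UNIV [simp]: "measure Omega_measure UNIV = ln 2"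
  by (simp add: measure_def emeasure_Omega_measure_UNIV)

section \<open>Sets visited with the expected frequency\<close>

definition equidist_set :: "real \<times> real \<Rightarrow> (real \<times> real) set \<Rightarrow> bool" where
  "equidist_set z A \<longleftrightarrow> A \<in> sets borel \<and> has_freq (\<lambda>n. (T ^^ n) z \<in> A) (measure Omega_measure A / ln 2)"

lemma equidist_set_empty: "equidist_set z {}"
  by (simp add: equidist_set_def has_freq_False)

lemma equidist_set_Diff:
  assumes "equidist_set z A" "equidist_set z B" "B \<subseteq> A"
  shows "equidist_set z (A - B)"
proof -
  have "measure Omega_measure (A - B) = measure Omega_measure A - measure Omega_measure B"
    using assms by (intro Om.finite_measure_Diff) (auto simp: equidist_set_def)
  then show ?thesis
    using assms has_freq_diff[of "\<lambda>n. (T ^^ n) z \<in> A" _ "\<lambda>n. (T ^^ n) z \<in> B"]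
    by (auto simp: equidist_set_def diff_divide_distrib)
qed

lemma equidist_set_Un:
  assumes "equidist_set z A" "equidist_set z B" "equidist_set z (A \<inter> B)"
  shows "equidist_set z (A \<union> B)"
proof -
  have "measure Omega_measure (A \<union> B) = measure Omega_measure A + measure Omega_measure B - measure Omega_measure (A \<inter> B)"
    using assms by (intro measure_Un3) (auto simp: equidist_set_def fmeasurable_def less_top[symmetric])
  then show ?thesis
    using assms has_freq_disj[of "\<lambda>n. (T ^^ n) z \<in> A" _ "\<lambda>n. (T ^^ n) z \<in> B"]
    by (auto simp: equidist_set_def diff_divide_distrib add_divide_distrib)
qed

text \<open>Points outside \<open>irrational_Omega\<close> form a null set for
  \<open>Omega_measure\<close> and are never met by the orbit, so sides of boxes on rational lines
  may be added or removed at will.\<close>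

lemma equidist_set_cong:
  assumes z: "z \<in> irrational_Omega" and A: "equidist_set z A" "B \<in> sets borel"
    and eq: "A \<inter> irrational_Omega = B \<inter> irrational_Omega"
  shows "equidist_set z B"
proof -
  have "measure Omega_measure A = measure Omega_measure B"
    using A eq AE_Omega_measure_irrational
    by (intro measure_eq_AE) (auto simp: equidist_set_def elim!: eventually_mono)
  moreover have "(T ^^ n) z \<in> A \<longleftrightarrow> (T ^^ n) z \<in> B" for n
    using T_funpow_irrational_Omega[OF z, of n] eq by blast
  ultimately show ?thesis using A by (simp add: equidist_set_def)
qed

lemma equidist_set_corner:
  assumes z: "z \<in> irrational_Omega" "equidist (fst z)"
    and s: "s \<in> \<rat>" "0 \<le> s" "s \<le> 1" and c: "c \<in> \<rat>" "1 \<le> c"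
  shows "equidist_set z {w. fst w < s \<and> snd w < - c}"
proof -
  have "measure Omega_measure {w. fst w < s \<and> snd w < - c} = ln (1 + s / c)"
    using s c by (simp add: measure_def emeasure_Omega_corner)
  moreover have "{w :: real \<times> real. fst w < s \<and> snd w < - c} \<in> sets borel"
    by (intro borel_open open_Collect_conj open_Collect_less continuous_intros)
  ultimately show ?thesis
    using corner_freq_Rats[OF z c] s by (simp add: equidist_set_def corner_freq_def)
qed

lemma equidist_set_box:
  assumes z: "z \<in> irrational_Omega" "equidist (fst z)"
    and rat: "a1 \<in> \<rat>" "a2 \<in> \<rat>" "b1 \<in> \<rat>" "b2 \<in> \<rat>"
  shows "equidist_set z (Omega \<inter> {a1<..<b1} \<times> {a2<..<b2})"
proof (cases "max 0 a1 < min 1 b1 \<and> a2 < min (-1) b2")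
  case False
  then have "Omega \<inter> {a1<..<b1} \<times> {a2<..<b2} = {}"
    by (auto simp: Omega_def)
  then show ?thesis by (simp add: equidist_set_empty)
next
  case True
  \<comment> \<open>The box is clipped to \<open>Omega\<close> so that its sides fall in the range
    where corners are known. A rectangle is then a double difference of four corners, up to the
    sides x = s and y = -d, which contain no point of \<open>irrational_Omega\<close>.\<close>
  define s where "s = max 0 a1"
  define t where "t = min 1 b1"
  define c where "c = - min (-1) b2"
  define d where "d = - a2"
  have r: "s \<in> \<rat>" "t \<in> \<rat>" "c \<in> \<rat>" "d \<in> \<rat>" and o: "0 \<le> s" "s < t" "t \<le> 1" "1 \<le> c" "c < d"
    using rat True by (auto simp: s_def t_def c_def d_def max_def min_def)
  define H where "H s c = {w :: real \<times> real. fst w < s \<and> snd w < - c}" for s c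
  have "equidist_set z ((H t c - H s c) - (H t d - H s d))"
    using r o unfolding H_def
    by (intro equidist_set_Diff equidist_set_corner z) (auto simp: not_less)
  then show ?thesis
  proof (rule equidist_set_cong[OF z(1)])
    show "Omega \<inter> {a1<..<b1} \<times> {a2<..<b2} \<in> sets borel"
      by (intro borel_open open_Int open_Omega open_Times) auto
    have "u \<noteq> s \<and> v \<noteq> - d" if "(u, v) \<in> irrational_Omega" for u v
    proof -
      have "- d \<in> \<rat>" using r by simp
      with that r show ?thesis by (auto simp: irrational_Omega_def)
    qed
    then show "((H t c - H s c) - (H t d - H s d)) \<inter> irrational_Omega =
        (Omega \<inter> {a1<..<b1} \<times> {a2<..<b2}) \<inter> irrational_Omega"
      using o by (fastforce simp: H_def s_def t_def c_def d_def irrational_Omega_def Omega_def)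
  qed
qed

definition rational_box_family :: "(real \<times> real) set set" where
  "rational_box_family = {Omega \<inter> {a1<..<b1} \<times> {a2<..<b2} | a1 a2 b1 b2.
    a1 \<in> \<rat> \<and> a2 \<in> \<rat> \<and> b1 \<in> \<rat> \<and> b2 \<in> \<rat>}"

lemma rational_box_family_Int:
  assumes "A \<in> rational_box_family" "B \<in> rational_box_family"
  shows "A \<inter> B \<in> rational_box_family"
proof -
  obtain a1 a2 b1 b2 where A: "A = Omega \<inter> {a1<..<b1} \<times> {a2<..<b2}"
    "a1 \<in> \<rat>" "a2 \<in> \<rat>" "b1 \<in> \<rat>" "b2 \<in> \<rat>" using assms(1) by (auto simp: rational_box_family_def)
  obtain c1 c2 d1 d2 where B: "B = Omega \<inter> {c1<..<d1} \<times> {c2<..<d2}"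
    "c1 \<in> \<rat>" "c2 \<in> \<rat>" "d1 \<in> \<rat>" "d2 \<in> \<rat>" using assms(2) by (auto simp: rational_box_family_def)
  have "A \<inter> B = Omega \<inter> {max a1 c1<..<min b1 d1} \<times> {max a2 c2<..<min b2 d2}"
    unfolding A B by auto
  moreover have "max a1 c1 \<in> \<rat>" "max a2 c2 \<in> \<rat>" "min b1 d1 \<in> \<rat>" "min b2 d2 \<in> \<rat>"
    using A B by (auto simp: max_def min_def)
  ultimately show ?thesis unfolding rational_box_family_def by blast
qed

lemma countable_rational_box_family: "countable rational_box_family"
proof -
  have "rational_box_family = (\<lambda>(a1, a2, b1, b2). Omega \<inter> {a1<..<b1} \<times> {a2<..<b2}) ` (\<rat> \<times> \<rat> \<times> \<rat> \<times> \<rat>)"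
    unfolding rational_box_family_def by force
  then show ?thesis
    by (metis countable_image countable_SIGMA countable_rat)
qed

lemma equidist_set_finite_Union:
  assumes z: "z \<in> irrational_Omega" "equidist (fst z)"
    and fin: "finite \<B>" and sub: "\<B> \<subseteq> rational_box_family"
  shows "equidist_set z (\<Union>\<B>)"
proof -
  have basic: "equidist_set z A" if "A \<in> rational_box_family" for A
    using that equidist_set_box[OF z] by (auto simp: rational_box_family_def)
  \<comment> \<open>Adding a box to a union requires the overlap, which is again a union of boxes
    cut by a box. The claim is therefore proved for every cutting box A at once: the triple overlap
    falls under the induction hypothesis for the box \<open>A \<inter> B\<close>.\<close>
  have Int: "equidist_set z (A \<inter> \<Union>\<B>)"
    if "finite \<B>" "\<B> \<subseteq> rational_box_family" "A \<in> rational_box_family" for A \<B>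
    using that
  proof (induction arbitrary: A rule: finite_induct)
    case empty
    then show ?case by (simp add: equidist_set_empty)
  next
    case (insert B \<B>)
    have "equidist_set z ((A \<inter> B) \<union> (A \<inter> \<Union>\<B>))"
    proof (rule equidist_set_Un)
      have AB: "A \<inter> B \<in> rational_box_family" using insert.prems by (intro rational_box_family_Int) auto
      then show "equidist_set z (A \<inter> B)" by (rule basic)
      show "equidist_set z (A \<inter> \<Union>\<B>)" using insert by auto
      have "equidist_set z ((A \<inter> B) \<inter> \<Union>\<B>)" using AB insert by auto
      then show "equidist_set z ((A \<inter> B) \<inter> (A \<inter> \<Union>\<B>))" by (simp add: Int_ac)
    qed
    then show ?case by (simp add: Int_Un_distrib)
  qed
  show ?thesis
    using fin sub
  proof (induction rule: finite_induct)
    case empty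
    then show ?case by (simp add: equidist_set_empty)
  next
    case (insert B \<B>)
    then have "equidist_set z (B \<union> \<Union>\<B>)"
      using basic[of B] Int[of \<B> B] by (intro equidist_set_Un) auto
    then show ?case by simp
  qed
qed

section \<open>Open sets and sets with null boundary\<close>

lemma open_subset_Omega_eq_Union:
  assumes "open U" "U \<subseteq> Omega"
  shows "U = \<Union>{A \<in> rational_box_family. A \<subseteq> U}"
proof
  show "U \<subseteq> \<Union>{A \<in> rational_box_family. A \<subseteq> U}"
  proof
    fix w assume w: "w \<in> U"
    obtain e where e: "0 < e" "ball w e \<subseteq> U" using assms(1) w openE by blast
    obtain a b :: "real \<times> real" where ab: "\<forall>i\<in>Basis. a \<bullet> i \<in> \<rat> \<and> b \<bullet> i \<in> \<rat>" "w \<in> box a b" "box a b \<subseteq> ball w e"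
      using rational_boxes[OF e(1), of w] by metis
    have "box a b = {fst a<..<fst b} \<times> {snd a<..<snd b}"
      by (auto simp: box_def Basis_prod_def inner_prod_def)
    moreover have "fst a \<in> \<rat>" "snd a \<in> \<rat>" "fst b \<in> \<rat>" "snd b \<in> \<rat>"
      using ab(1) by (auto simp: Basis_prod_def inner_prod_def)
    ultimately have "Omega \<inter> box a b \<in> rational_box_family"
      unfolding rational_box_family_def by auto
    moreover have "Omega \<inter> box a b \<subseteq> U" "w \<in> Omega \<inter> box a b" using ab e w assms by auto
    ultimately show "w \<in> \<Union>{A \<in> rational_box_family. A \<subseteq> U}" by blast
  qed
qed blast

text \<open>Finite unions of rational boxes increase to U and have their exact frequencies;
  continuity of the measure from below gives the bound. For general open U only this half is
  available, as a boundary of positive measure may spoil the other.\<close>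

lemma equidist_open_lower:
  assumes z: "z \<in> irrational_Omega" "equidist (fst z)"
    and U: "open U" "U \<subseteq> Omega" and l: "l < measure Omega_measure U / ln 2"
  shows "\<forall>\<^sub>F N in sequentially. l < real (card {n. n < N \<and> (T ^^ n) z \<in> U}) / real N"
proof -
  define \<B> where "\<B> = {A \<in> rational_box_family. A \<subseteq> U}"
  have UB: "U = \<Union>\<B>" unfolding \<B>_def by (rule open_subset_Omega_eq_Union[OF U])
  have "countable \<B>" unfolding \<B>_def using countable_rational_box_family by (rule countable_subset[rotated]) auto
  \<comment> \<open>An enumeration by the natural numbers needs a nonempty family; a degenerate box
    supplies the empty set, which lies inside every U.\<close>
  moreover have "\<B> \<noteq> {}"
  proof -
    have "{} = Omega \<inter> {0<..<0} \<times> {0<..<0}" by auto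
    then have "{} \<in> \<B>" unfolding \<B>_def rational_box_family_def using Rats_0 by blast
    then show ?thesis by blast
  qed
  ultimately obtain E where E: "\<B> = range (E :: nat \<Rightarrow> _)"
    by (metis uncountable_def)
  define V where "V k = \<Union>(E ` {..<k})" for k :: nat
  have V: "equidist_set z (V k)" for k
    unfolding V_def using E by (intro equidist_set_finite_Union z) (auto simp: \<B>_def)
  have UV: "(\<Union>k. V k) = U" unfolding UB E V_def by auto
  have "(\<lambda>k. measure Omega_measure (V k)) \<longlonglongrightarrow> measure Omega_measure (\<Union>k. V k)"
  proof (rule Om.finite_Lim_measure_incseq)
    show "incseq V" unfolding incseq_def V_def by (intro allI impI Union_mono image_mono) auto
  qed (use V in \<open>auto simp: equidist_set_def\<close>)
  then have "(\<lambda>k. measure Omega_measure (V k) / ln 2) \<longlonglongrightarrow> measure Omega_measure U / ln 2"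
    unfolding UV by (intro tendsto_divide) auto
  from order_tendstoD(1)[OF this l] obtain k where k: "l < measure Omega_measure (V k) / ln 2"
    by (auto simp: eventually_sequentially)
  have "(\<lambda>N. real (card {n. n < N \<and> (T ^^ n) z \<in> V k}) / real N) \<longlonglongrightarrow> measure Omega_measure (V k) / ln 2"
    using V[of k] by (simp add: equidist_set_def has_freq_def)
  from order_tendstoD(1)[OF this k] show ?thesis
  proof eventually_elim
    case (elim N)
    have "card {n. n < N \<and> (T ^^ n) z \<in> V k} \<le> card {n. n < N \<and> (T ^^ n) z \<in> U}"
      using UV by (intro card_mono) auto
    then have "real (card {n. n < N \<and> (T ^^ n) z \<in> V k}) / real N \<le> real (card {n. n < N \<and> (T ^^ n) z \<in> U}) / real N"
      by (intro divide_right_mono) auto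
    with elim show ?case by linarith
  qed
qed

text \<open>The lower bound is applied to two open sets, the interior of B and the exterior of B in
  \<open>Omega\<close>. As the boundary is null, their measures add up to \<open>ln 2\<close>, and
  visits to the exterior are not visits to B, so the second lower bound becomes an upper bound for
  B.\<close>

lemma equidist_set_null_frontier:
  assumes z: "z \<in> irrational_Omega" "equidist (fst z)"
    and B: "B \<in> sets borel" "B \<subseteq> Omega" "emeasure lborel (frontier B) = 0"
  shows "equidist_set z B"
proof -
  define m where "m = measure Omega_measure B"
  have "AE w in lborel. w \<notin> frontier B"
    using B(3) by (intro AE_not_in) (simp add: null_sets_def borel_closed)
  then have nofront: "AE w in Omega_measure. w \<in> Omega \<and> w \<notin> frontier B"
    unfolding AE_Omega_measure_iff by eventually_elim simp
  have mint: "measure Omega_measure (interior B) = m"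
    unfolding m_def
  proof (rule measure_eq_AE)
    show "AE w in Omega_measure. w \<in> interior B \<longleftrightarrow> w \<in> B"
      using nofront
      by eventually_elim (use interior_subset[of B] closure_subset[of B] in \<open>auto simp: frontier_def\<close>)
  qed (use B in auto)
  have mout: "measure Omega_measure (Omega - closure B) = ln 2 - m"
  proof -
    have "measure Omega_measure (Omega - closure B) = measure Omega_measure (UNIV - B)"
    proof (rule measure_eq_AE)
      show "AE w in Omega_measure. w \<in> Omega - closure B \<longleftrightarrow> w \<in> UNIV - B"
        using nofront
        by eventually_elim (use interior_subset[of B] closure_subset[of B] in \<open>auto simp: frontier_def\<close>)
    qed (use B in auto)
    also have "\<dots> = ln 2 - m"
      unfolding m_def using B(1) by (subst Om.finite_measure_Diff) auto
    finally show ?thesis .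
  qed
  define c where "c A N = real (card {n. n < N \<and> (T ^^ n) z \<in> A}) / real N" for A N
  have "c B \<longlonglongrightarrow> m / ln 2"
  proof (rule order_tendstoI)
    fix l assume "l < m / ln 2"
    then have "\<forall>\<^sub>F N in sequentially. l < c (interior B) N"
      unfolding c_def using B interior_subset[of B] by (intro equidist_open_lower z) (auto simp: mint)
    then show "\<forall>\<^sub>F N in sequentially. l < c B N"
    proof eventually_elim
      case (elim N)
      have "c (interior B) N \<le> c B N"
        unfolding c_def using interior_subset[of B]
        by (intro divide_right_mono of_nat_mono card_mono) auto
      with elim show ?case by linarith
    qed
  next
    fix l assume "m / ln 2 < l"
    then have "\<forall>\<^sub>F N in sequentially. 1 - l < c (Omega - closure B) N"
      unfolding c_def using open_Omega
      by (intro equidist_open_lower z) (auto simp: mout diff_divide_distrib open_Diff)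
    then show "\<forall>\<^sub>F N in sequentially. c B N < l"
      using eventually_gt_at_top[of 0]
    proof eventually_elim
      case (elim N)
      have "card {n. n < N \<and> (T ^^ n) z \<in> B} + card {n. n < N \<and> (T ^^ n) z \<in> Omega - closure B} =
        card ({n. n < N \<and> (T ^^ n) z \<in> B} \<union> {n. n < N \<and> (T ^^ n) z \<in> Omega - closure B})"
        using closure_subset[of B] by (intro card_Un_disjoint[symmetric]) auto
      also have "\<dots> \<le> card {..<N}" by (intro card_mono) auto
      finally have "real (card {n. n < N \<and> (T ^^ n) z \<in> B}) + real (card {n. n < N \<and> (T ^^ n) z \<in> Omega - closure B}) \<le> real N"
        by (simp flip: of_nat_add)
      then have "c B N + c (Omega - closure B) N \<le> 1"
        unfolding c_def add_divide_distrib[symmetric] using elim by simp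
      with elim show ?case by linarith
    qed
  qed
  then show ?thesis
    using B by (simp add: equidist_set_def has_freq_def c_def[abs_def] m_def)
qed

section \<open>The first return map\<close>

text \<open>A nonempty open set is not Lebesgue negligible, and the density is positive on
  \<open>Omega\<close>. This makes the frequency of visits to \<open>Omega_sub \<alpha>\<close>
  positive, so that it may be divided by.\<close>

lemma measure_Omega_measure_pos:
  assumes "open U" "U \<subseteq> Omega" "U \<noteq> {}"
  shows "0 < measure Omega_measure U"
proof -
  have "emeasure Omega_measure U \<noteq> 0"
  proof
    assume "emeasure Omega_measure U = 0"
    then have "AE w in Omega_measure. w \<notin> U"
      using assms by (intro AE_not_in) (auto simp: null_sets_def)
    then have "AE w in lborel. w \<notin> U"
      unfolding AE_Omega_measure_iff using assms by (auto elim!: eventually_mono)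
    then have "emeasure lborel U = 0"
      using assms by (simp add: AE_iff_measurable[of U])
    then have "U \<in> null_sets lborel" using assms by (simp add: null_sets_def)
    then have "negligible U" by (simp add: negligible_iff_null_sets null_sets_completionI)
    then show False using open_not_negligible assms by blast
  qed
  then show ?thesis by (simp add: Om.emeasure_eq_measure zero_less_measure_iff)
qed

lemma Omega_sub_eq:
  assumes "0 < \<alpha>"
  shows "Omega_sub \<alpha> = Omega \<inter> {w. 1 / \<alpha> < fst w - snd w}"
  using assms by (auto simp: Omega_sub_def Omega_def field_simps)

text \<open>On \<open>Omega\<close> the difference x - y is positive, so the defining inequality
  cuts out an open half-plane. The result is convex, and the boundary of a convex set is
  negligible.\<close>

lemma Omega_sub_regular:
  assumes "0 < \<alpha>"
  shows "open (Omega_sub \<alpha>)" "Omega_sub \<alpha> \<subseteq> Omega" "Omega_sub \<alpha> \<noteq> {}"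
    "emeasure lborel (frontier (Omega_sub \<alpha>)) = 0"
proof -
  show "open (Omega_sub \<alpha>)"
    unfolding Omega_sub_eq[OF assms]
    by (intro open_Int open_Omega open_Collect_less continuous_intros)
  show "Omega_sub \<alpha> \<subseteq> Omega" by (auto simp: Omega_sub_def)
  \<comment> \<open>Here x - y equals 1/\<alpha> + 3/2, which exceeds 1/\<alpha>, and y < -1 because
    \<alpha> is positive.\<close>
  have "(1 / 2, - (1 / \<alpha>) - 1) \<in> Omega_sub \<alpha>"
    unfolding Omega_sub_eq[OF assms] using assms by (auto simp: Omega_def)
  then show "Omega_sub \<alpha> \<noteq> {}" by blast
  have "convex (Omega_sub \<alpha>)"
  proof -
    have "{w :: real \<times> real. 1 / \<alpha> < fst w - snd w} = {w. inner (1, -1) w > 1 / \<alpha>}"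
      by (auto simp: inner_prod_def)
    then show ?thesis
      unfolding Omega_sub_eq[OF assms] Omega_def
      by (auto intro!: convex_Int convex_Times convex_halfspace_gt)
  qed
  then have "negligible (frontier (Omega_sub \<alpha>))" by (rule negligible_convex_frontier)
  then have "emeasure lebesgue (frontier (Omega_sub \<alpha>)) = 0"
    by (simp add: negligible_iff_null_sets null_sets_def)
  then show "emeasure lborel (frontier (Omega_sub \<alpha>)) = 0"
    by (simp add: emeasure_completion)
qed

lemma lebesgue_integral_Omega_density:
  assumes "B \<in> sets borel" "B \<subseteq> Omega"
  shows "set_lebesgue_integral lborel B (\<lambda>(x, y). 1 / (x - y)\<^sup>2) = measure Omega_measure B"
proof -
  note [measurable] = assms(1)
  define g :: "real \<times> real \<Rightarrow> real" where "g = (\<lambda>w. (\<lambda>(x, y). indicator Omega (x, y) / (x - y)\<^sup>2) w)"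
  have [measurable]: "g \<in> borel_measurable borel" unfolding g_def by measurable
  have "set_lebesgue_integral lborel B (\<lambda>(x, y). 1 / (x - y)\<^sup>2) = (\<integral>w. g w * indicator B w \<partial>lborel)"
    unfolding set_lebesgue_integral_def using assms(2)
    by (intro Bochner_Integration.integral_cong) (auto simp: g_def indicator_def)
  also have "\<dots> = enn2real (\<integral>\<^sup>+w. ennreal (g w * indicator B w) \<partial>lborel)"
    by (intro integral_eq_nn_integral) (auto simp: g_def)
  also have "(\<integral>\<^sup>+w. ennreal (g w * indicator B w) \<partial>lborel) = emeasure Omega_measure B"
    unfolding Omega_measure_def
    by (subst emeasure_density, simp, simp, intro nn_integral_cong) (auto simp: g_def indicator_def)
  finally show ?thesis by (simp add: measure_def)
qed

lemma integral_f_dens: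
  assumes "B \<in> sets borel" "B \<subseteq> Omega_sub \<alpha>" "0 < \<alpha>"
  shows "set_lebesgue_integral lborel B (f_dens \<alpha>) = measure Omega_measure B / measure Omega_measure (Omega_sub \<alpha>)"
proof -
  have "set_lebesgue_integral lborel B (f_dens \<alpha>) =
      (\<integral>w. c_norm \<alpha> * (indicator B w *\<^sub>R (\<lambda>(x, y). 1 / (x - y)\<^sup>2) w) \<partial>lborel)"
    unfolding set_lebesgue_integral_def
    by (intro Bochner_Integration.integral_cong) (auto simp: f_dens_def)
  also have "\<dots> = c_norm \<alpha> * set_lebesgue_integral lborel B (\<lambda>(x, y). 1 / (x - y)\<^sup>2)"
    unfolding set_lebesgue_integral_def by simp
  also have "\<dots> = inverse (measure Omega_measure (Omega_sub \<alpha>)) * measure Omega_measure B"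
    using assms Omega_sub_regular[OF assms(3)]
    by (simp add: c_norm_def lebesgue_integral_Omega_density borel_open)
  finally show ?thesis by (simp add: divide_inverse)
qed

section \<open>Return times and visits of the induced map\<close>

lemma infinite_of_has_freq_pos:
  assumes "has_freq P p" "0 < p"
  shows "\<exists>n>m. P n"
proof (rule ccontr)
  assume "\<not> (\<exists>n>m. P n)"
  then have sub: "{n. n < N \<and> P n} \<subseteq> {..m}" for N by (auto simp: not_less)
  have "real (card {n. n < N \<and> P n}) \<le> real (Suc m)" for N
    using card_mono[OF _ sub[of N]] by simp
  then have le: "real (card {n. n < N \<and> P n}) / real N \<le> real (Suc m) / real N" for N
    by (intro divide_right_mono) auto
  have "p \<le> 0"
  proof (rule LIMSEQ_le)
    show "(\<lambda>N. real (card {n. n < N \<and> P n}) / real N) \<longlonglongrightarrow> p" using assms by (simp add: has_freq_def)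
    show "(\<lambda>N. real (Suc m) / real N) \<longlonglongrightarrow> 0" by real_asymp
  qed (use le in blast)
  with assms show False by simp
qed

text \<open>Up to time \<open>v k\<close> there are exactly k visits to A, so k / \<open>v k\<close>
  tends to a. Every visit to B is a visit to A and hence happens at some \<open>v j\<close>;
  counting these visits up to \<open>v k\<close> and dividing by k gives b / a.\<close>

lemma has_freq_return_times:
  fixes Z :: "nat \<Rightarrow> 'a" and v :: "nat \<Rightarrow> nat"
  assumes A: "has_freq (\<lambda>n. Z n \<in> A) a" "0 < a" and B: "has_freq (\<lambda>n. Z n \<in> B) b" "B \<subseteq> A"
    and v0: "v 0 = 0" and v: "\<And>k. v (Suc k) = (LEAST n. v k < n \<and> Z n \<in> A)"
  shows "(\<lambda>k. 1 / real k * real (card {j. 0 < j \<and> j < k \<and> Z (v j) \<in> B})) \<longlonglongrightarrow> b / a"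
proof -
  have step: "v k < v (Suc k)" "Z (v (Suc k)) \<in> A" for k
    using LeastI_ex[of "\<lambda>n. v k < n \<and> Z n \<in> A"] infinite_of_has_freq_pos[OF A, of "v k"]
    unfolding v[symmetric] by blast+
  have between: "n = v (Suc k)" if "v k < n" "n \<le> v (Suc k)" "Z n \<in> A" for n k
    using Least_le[of "\<lambda>n. v k < n \<and> Z n \<in> A" n] that unfolding v[symmetric] by simp
  have "strict_mono v" using step by (intro strict_monoI_Suc) auto
  then have vlim: "filterlim v at_top sequentially" by (rule filterlim_subseq)
  \<comment> \<open>The times counted are 1, ..., \<open>v k\<close>. Time 0 is left out because the
    orbit need not start in A, and this matches the range 0 < j on the right.\<close>
  have count: "card {n. n < v k \<and> Z (Suc n) \<in> C} = card {j. 0 < j \<and> j < Suc k \<and> Z (v j) \<in> C}"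
    if "C \<subseteq> A" for C k
  proof (induction k)
    case 0
    have "{j. 0 < j \<and> j < Suc 0 \<and> Z (v j) \<in> C} = {}" by auto
    then show ?case by (simp only:) (simp add: v0)
  next
    case (Suc k)
    define e where "e = v (Suc k) - 1"
    have e: "Suc e = v (Suc k)" using step[of k] by (simp add: e_def)
    have "{n. n < v (Suc k) \<and> Z (Suc n) \<in> C} = {n. n < v k \<and> Z (Suc n) \<in> C} \<union> {n. n = e \<and> Z (v (Suc k)) \<in> C}"
    proof (intro set_eqI iffI)
      fix n assume n: "n \<in> {n. n < v (Suc k) \<and> Z (Suc n) \<in> C}"
      show "n \<in> {n. n < v k \<and> Z (Suc n) \<in> C} \<union> {n. n = e \<and> Z (v (Suc k)) \<in> C}"
      proof (cases "n < v k")
        case False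
        then have "Suc n = v (Suc k)" using n that by (intro between) auto
        then show ?thesis using n e by auto
      qed (use n in auto)
    next
      fix n assume "n \<in> {n. n < v k \<and> Z (Suc n) \<in> C} \<union> {n. n = e \<and> Z (v (Suc k)) \<in> C}"
      then show "n \<in> {n. n < v (Suc k) \<and> Z (Suc n) \<in> C}" using e step(1)[of k] by auto
    qed
    moreover have "card ({n. n < v k \<and> Z (Suc n) \<in> C} \<union> {n. n = e \<and> Z (v (Suc k)) \<in> C}) =
        card {n. n < v k \<and> Z (Suc n) \<in> C} + card {n. n = e \<and> Z (v (Suc k)) \<in> C}"
      using e step(1)[of k] by (intro card_Un_disjoint) auto
    moreover have "{j. 0 < j \<and> j < Suc (Suc k) \<and> Z (v j) \<in> C} =
        {j. 0 < j \<and> j < Suc k \<and> Z (v j) \<in> C} \<union> {j. j = Suc k \<and> Z (v (Suc k)) \<in> C}"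
      by (auto simp: less_Suc_eq)
    moreover have "card ({j. 0 < j \<and> j < Suc k \<and> Z (v j) \<in> C} \<union> {j. j = Suc k \<and> Z (v (Suc k)) \<in> C}) =
        card {j. 0 < j \<and> j < Suc k \<and> Z (v j) \<in> C} + card {j. j = Suc k \<and> Z (v (Suc k)) \<in> C}"
      by (intro card_Un_disjoint) auto
    moreover have "card {n. n = e \<and> Z (v (Suc k)) \<in> C} = card {j. j = Suc k \<and> Z (v (Suc k)) \<in> C}"
      by (cases "Z (v (Suc k)) \<in> C") auto
    ultimately show ?case using Suc by simp
  qed
  have freq: "(\<lambda>k. real (card {n. n < v k \<and> Z (Suc n) \<in> C}) / real (v k)) \<longlonglongrightarrow> c"
    if "has_freq (\<lambda>n. Z n \<in> C) c" for C c
  proof -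
    have "has_freq (\<lambda>n. Z (Suc n) \<in> C) c"
      using that by (simp add: has_freq_Suc[of "\<lambda>n. Z n \<in> C"])
    from filterlim_compose[OF this[unfolded has_freq_def] vlim] show ?thesis .
  qed
  have visits: "card {n. n < v k \<and> Z (Suc n) \<in> A} = k" for k
  proof -
    have "Z (v j) \<in> A" if "0 < j" for j using that step(2)[of "j - 1"] by simp
    then have "{j. 0 < j \<and> j < Suc k \<and> Z (v j) \<in> A} = {1..k}" by auto
    then show ?thesis unfolding count[OF order_refl] by simp
  qed
  define cB where "cB k = real (card {n. n < v k \<and> Z (Suc n) \<in> B})" for k
  have "(\<lambda>k. (cB k / real (v k)) / (real k / real (v k))) \<longlonglongrightarrow> b / a"
    using freq[OF A(1)] freq[OF B(1)] A(2) unfolding visits cB_def by (intro tendsto_divide) auto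
  \<comment> \<open>The indices 0 < j < k + 1 number k, while the average divides by k + 1; this
    factor corrects for it.\<close>
  moreover have "(\<lambda>k. real k / real (Suc k)) \<longlonglongrightarrow> 1" by real_asymp
  ultimately have lim: "(\<lambda>k. (cB k / real (v k)) / (real k / real (v k)) * (real k / real (Suc k))) \<longlonglongrightarrow> b / a * 1"
    by (rule tendsto_mult)
  have "\<forall>\<^sub>F k in sequentially. (cB k / real (v k)) / (real k / real (v k)) * (real k / real (Suc k)) =
      1 / real (Suc k) * real (card {j. 0 < j \<and> j < Suc k \<and> Z (v j) \<in> B})"
    using eventually_gt_at_top[of 0]
  proof eventually_elim
    case (elim k)
    have "0 < v k" using step(1)[of "k - 1"] elim by simp
    then show ?case using elim unfolding cB_def count[OF B(2)] by (simp del: of_nat_Suc)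
  qed
  from Lim_transform_eventually[OF lim this] have "(\<lambda>k. 1 / real (Suc k) * real (card {j. 0 < j \<and> j < Suc k \<and> Z (v j) \<in> B})) \<longlonglongrightarrow> b / a"
    by (simp only: mult_1_right)
  then show ?thesis by (rule LIMSEQ_imp_Suc)
qed

text \<open>Return times add up: \<open>v (Suc j)\<close> is \<open>v j\<close> plus the value of
  \<open>tau\<close> at the point reached at time \<open>v j\<close>. Infinitely many visits ensure
  that each \<open>LEAST\<close> is attained.\<close>

lemma T_sub_funpow:
  assumes v0: "v 0 = 0" and v: "\<And>k. v (Suc k) = (LEAST n. v k < n \<and> (T ^^ n) z \<in> Omega_sub \<alpha>)"
    and inf: "\<And>m. \<exists>n>m. (T ^^ n) z \<in> Omega_sub \<alpha>"
  shows "(T_sub \<alpha> ^^ j) z = (T ^^ v j) z"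
proof (induction j)
  case 0
  then show ?case by (simp add: v0)
next
  case (Suc j)
  have add: "(T ^^ n) ((T ^^ m) z) = (T ^^ (n + m)) z" for n m
    by (simp add: funpow_add)
  define t where "t = tau \<alpha> ((T ^^ v j) z)"
  have "t + v j = v (Suc j)"
  proof -
    obtain n where n: "v j < n" "(T ^^ n) z \<in> Omega_sub \<alpha>" using inf by blast
    have ex: "1 \<le> n - v j \<and> (T ^^ (n - v j)) ((T ^^ v j) z) \<in> Omega_sub \<alpha>"
      using n by (simp add: add)
    have t: "1 \<le> t" "(T ^^ (t + v j)) z \<in> Omega_sub \<alpha>"
      using LeastI[of "\<lambda>n. 1 \<le> n \<and> (T ^^ n) ((T ^^ v j) z) \<in> Omega_sub \<alpha>", OF ex]
      unfolding t_def tau_def add by auto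
    have "t + v j \<le> m" if m: "v j < m" "(T ^^ m) z \<in> Omega_sub \<alpha>" for m
    proof -
      have "t \<le> m - v j" unfolding t_def tau_def using m by (intro Least_le) (simp add: add)
      then show ?thesis using m by simp
    qed
    then show ?thesis unfolding v using t by (intro Least_equality[symmetric]) auto
  qed
  then show ?case
    using Suc by (simp add: T_sub_def t_def[symmetric] add)
qed

theorem theorem2p5:
  fixes \<alpha> :: real
  assumes "0 < \<alpha>" and "\<alpha> \<le> 1"
  shows "AE z in (lborel :: (real \<times> real) measure). z \<in> Omega \<longrightarrow>
    (\<forall>B. B \<in> sets borel \<and> B \<subseteq> Omega_sub \<alpha> \<and> emeasure lborel (frontier B) = 0 \<longrightarrow>
      (\<lambda>k. 1 / real k * real (card {j. 0 < j \<and> j < k \<and> (T_sub \<alpha> ^^ j) z \<in> B}))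
        \<longlonglongrightarrow> set_lebesgue_integral lborel B (f_dens \<alpha>))"
  using AE_irrational_Omega AE_equidist
proof eventually_elim
  case (elim z)
  \<comment> \<open>The two conditions fixing z do not mention B, so a single null set serves all B
    simultaneously.\<close>
  show ?case
  proof (intro impI allI, elim conjE)
    fix B assume "z \<in> Omega" and B: "B \<in> sets borel" "B \<subseteq> Omega_sub \<alpha>" "emeasure lborel (frontier B) = 0"
    with elim have z: "z \<in> irrational_Omega" "equidist (fst z)" by auto
    note \<Omega> = Omega_sub_regular[OF assms(1)]
    define a where "a = measure Omega_measure (Omega_sub \<alpha>) / ln 2"
    define b where "b = measure Omega_measure B / ln 2"
    have fa: "has_freq (\<lambda>n. (T ^^ n) z \<in> Omega_sub \<alpha>) a"
      using equidist_set_null_frontier[OF z _ \<Omega>(2,4)] \<Omega>(1) by (simp add: equidist_set_def a_def)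
    have fb: "has_freq (\<lambda>n. (T ^^ n) z \<in> B) b"
      using equidist_set_null_frontier[OF z B(1) _ B(3)] B(2) \<Omega>(2) by (simp add: equidist_set_def b_def)
    have a: "0 < a"
      using measure_Omega_measure_pos[OF \<Omega>(1,2,3)] by (simp add: a_def)
    \<comment> \<open>\<open>v k\<close> is the time of the k-th visit to
      \<open>Omega_sub \<alpha>\<close> after time 0, whether or not z itself lies there.\<close>
    define v where "v = rec_nat 0 (\<lambda>k m. LEAST n. m < n \<and> (T ^^ n) z \<in> Omega_sub \<alpha>)"
    have v: "v 0 = 0" "v (Suc k) = (LEAST n. v k < n \<and> (T ^^ n) z \<in> Omega_sub \<alpha>)" for k
      by (simp_all add: v_def)
    have "(\<lambda>k. 1 / real k * real (card {j. 0 < j \<and> j < k \<and> (T_sub \<alpha> ^^ j) z \<in> B})) \<longlonglongrightarrow> b / a"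
      unfolding T_sub_funpow[OF v infinite_of_has_freq_pos[OF fa a]]
      by (rule has_freq_return_times[OF fa a fb B(2) v])
    \<comment> \<open>The factor \<open>ln 2\<close> in both frequencies cancels.\<close>
    also have "b / a = set_lebesgue_integral lborel B (f_dens \<alpha>)"
      using integral_f_dens[OF B(1,2) assms(1)] by (simp add: a_def b_def)
    finally show "(\<lambda>k. 1 / real k * real (card {j. 0 < j \<and> j < k \<and> (T_sub \<alpha> ^^ j) z \<in> B}))
        \<longlonglongrightarrow> set_lebesgue_integral lborel B (f_dens \<alpha>)" .
  qed
qed

end
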